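(* Let $H_+$ be a finite-dimensional Hopf algebra over $\mathbb{C}$ with invertible antipode, let $H=D(H_+)$ be its quantum double, and suppose $H$ is equipped with an involution $\tau$ such that $\tau(H_+)\subset H_+$ and $\tau(H_-)\subset H_-$. Then the RE dual algebra $H^\circledast$ has no characters (unital algebra homomorphisms $H^\circledast\to\mathbb{C}$) unless $\dim H=1$.
   Context: All algebras are over $\mathbb{C}$; summation over tensor components is suppressed. The superscript $op$ denotes opposite comultiplication. Quantum double: put $H_-=H_+^{*op}$ (the dual Hopf algebra with opposite comultiplication). $H=D(H_+)$ equals $H_+\otimes H_-$ as a vector space and as an $H_+$-$H_-$-bimodule (write $x\xi$ for $x\otimes\xi$), both factors are sub-bialgebras, and the cross relations are $\langle\xi^{(1)},x^{(1)}\rangle\,\xi^{(2)}x^{(2)}=x^{(1)}\xi^{(1)}\langle\xi^{(2)},x^{(2)}\rangle$ for $\xi\in H_-$, $x\in H_+$, with Sweedler components taken in $H_\pm$ and $\langle\cdot,\cdot\rangle$ the canonical pairing of $H_+^*$ with $H_+$. With dual bases $\{e_\mu\}\subset H_+$, $\{e^\mu\}\subset H_+^*$, the universal R-matrix is $\mathcal{R}=\bigl(\sum_\mu e^\mu\otimes e_\mu\bigr)^{-1}\in H_-\otimes H_+\subset H\otimes H$. Involution: $\tau\colon H\to H$ is linear with $\tau^2=\mathrm{id}$, a coalgebra map and an anti-automorphism of algebras. $H^*$ is the dual algebra (product $m$ dual to the coproduct of $H$), an $H$-bimodule by $\langle h\triangleright a,x\rangle=\langle a,xh\rangle$, $\langle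 a\triangleleft h,x\rangle=\langle a,hx\rangle$. The RE dual $H^\circledast$ is the vector space $H^*$ with the associative product $\tilde m(a\otimes b)=m\bigl(\tau(\bar{\mathcal{R}}_1)\triangleright a\otimes b\triangleleft\bar{\mathcal{R}}_2\bigr)$, where $\bar{\mathcal R}=\mathcal{R}^{-1}=\bar{\mathcal R}_1\otimes\bar{\mathcal R}_2$. *)

theory Defs
  imports Complex_Main "HOL-Library.Poly_Mapping"
begin

section \<open>Complex vector spaces\<close>

class complex_vector = ab_group_add +
  fixes scaleC :: "complex \<Rightarrow> 'a \<Rightarrow> 'a"  (infixr \<open>*\<^sub>C\<close> 75)
  assumes scaleC_add_right: "a *\<^sub>C (x + y) = a *\<^sub>C x + a *\<^sub>C y"
    and scaleC_add_left: "(a + b) *\<^sub>C x = a *\<^sub>C x + b *\<^sub>C x"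
    and scaleC_scaleC: "a *\<^sub>C b *\<^sub>C x = (a * b) *\<^sub>C x"
    and scaleC_one: "1 *\<^sub>C x = x"

interpretation complex_vector: vector_space "scaleC :: complex \<Rightarrow> 'a \<Rightarrow> 'a::complex_vector"
  by unfold_locales (simp_all add: scaleC_add_right scaleC_add_left scaleC_scaleC scaleC_one)

instantiation complex :: complex_vector
begin
definition scaleC_complex :: "complex \<Rightarrow> complex \<Rightarrow> complex" where
  "scaleC_complex a z = a * z"
instance by standard (simp_all add: scaleC_complex_def algebra_simps)
end

abbreviation clinear :: "('a::complex_vector \<Rightarrow> 'b::complex_vector) \<Rightarrow> bool" where
  "clinear \<equiv> Vector_Spaces.linear scaleC scaleC"

lemma clinear_iff:
  "clinear f \<longleftrightarrow> (\<forall>x y. f (x + y) = f x + f y) \<and> (\<forall>c x. f (c *\<^sub>C x) = c *\<^sub>C f x)"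
  by (simp add: Vector_Spaces.linear_iff complex_vector.vector_space_axioms)

definition cbilinear :: "('a::complex_vector \<Rightarrow> 'b::complex_vector \<Rightarrow> 'c::complex_vector) \<Rightarrow> bool" where
  "cbilinear f \<longleftrightarrow> (\<forall>x. clinear (f x)) \<and> (\<forall>y. clinear (\<lambda>x. f x y))"


section \<open>Tensor products\<close>

text \<open>The free vector space on a set, as finitely supported functions.\<close>

instantiation poly_mapping :: (type, complex_vector) complex_vector
begin
lift_definition scaleC_poly_mapping :: "complex \<Rightarrow> ('a \<Rightarrow>\<^sub>0 'b) \<Rightarrow> ('a \<Rightarrow>\<^sub>0 'b)"
  is "\<lambda>c u k. c *\<^sub>C u k"
  by (erule rev_finite_subset) auto
instance
  by standard
    (transfer, simp add: fun_eq_iff scaleC_add_right scaleC_add_left scaleC_scaleC scaleC_one)+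
end

definition tensor_relations ::
    "(('a::complex_vector \<times> 'b::complex_vector) \<Rightarrow>\<^sub>0 complex) set" where
  "tensor_relations =
     {Poly_Mapping.single (x + x', y) 1 - Poly_Mapping.single (x, y) 1 - Poly_Mapping.single (x', y) 1 | x x' y. True}
   \<union> {Poly_Mapping.single (x, y + y') 1 - Poly_Mapping.single (x, y) 1 - Poly_Mapping.single (x, y') 1 | x y y'. True}
   \<union> {Poly_Mapping.single (c *\<^sub>C x, y) 1 - c *\<^sub>C Poly_Mapping.single (x, y) 1 | c x y. True}
   \<union> {Poly_Mapping.single (x, c *\<^sub>C y) 1 - c *\<^sub>C Poly_Mapping.single (x, y) 1 | c x y. True}"

definition tensor_eq ::
    "(('a::complex_vector \<times> 'b::complex_vector) \<Rightarrow>\<^sub>0 complex) \<Rightarrow> (('a \<times> 'b) \<Rightarrow>\<^sub>0 complex) \<Rightarrow> bool" where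
  "tensor_eq u v \<longleftrightarrow> u - v \<in> complex_vector.span tensor_relations"

quotient_type (overloaded) ('a, 'b) tensor =
    "('a::complex_vector \<times> 'b::complex_vector) \<Rightarrow>\<^sub>0 complex" / tensor_eq
proof (rule equivpI)
  show "reflp tensor_eq"
    by (simp add: reflp_def tensor_eq_def complex_vector.span_zero)
  show "symp tensor_eq"
    unfolding tensor_eq_def by (rule sympI) (drule complex_vector.span_neg, simp)
  show "transp tensor_eq"
    unfolding tensor_eq_def by (rule transpI) (drule (1) complex_vector.span_add, simp)
qed

instantiation tensor :: (complex_vector, complex_vector) complex_vector
begin
lift_definition zero_tensor :: "('a, 'b) tensor" is 0 .
lift_definition plus_tensor :: "('a, 'b) tensor \<Rightarrow> ('a, 'b) tensor \<Rightarrow> ('a, 'b) tensor" is "(+)"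
  unfolding tensor_eq_def
  by (drule (1) complex_vector.span_add) (simp only: add_diff_add)
lift_definition minus_tensor :: "('a, 'b) tensor \<Rightarrow> ('a, 'b) tensor \<Rightarrow> ('a, 'b) tensor" is "(-)"
  unfolding tensor_eq_def
  by (drule (1) complex_vector.span_diff) (simp add: algebra_simps)
lift_definition uminus_tensor :: "('a, 'b) tensor \<Rightarrow> ('a, 'b) tensor" is "uminus"
  unfolding tensor_eq_def by (drule complex_vector.span_neg) simp
lift_definition scaleC_tensor :: "complex \<Rightarrow> ('a, 'b) tensor \<Rightarrow> ('a, 'b) tensor" is scaleC
  unfolding tensor_eq_def
  by (drule complex_vector.span_scale) (simp add: complex_vector.scale_right_diff_distrib)
instance
  by standard
    (transfer, simp add: tensor_eq_def complex_vector.span_zero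
       scaleC_add_right scaleC_add_left scaleC_scaleC scaleC_one ac_simps)+
end

lift_definition tensor :: "'a::complex_vector \<Rightarrow> 'b::complex_vector \<Rightarrow> ('a, 'b) tensor"
    (infixl \<open>\<otimes>\<close> 72)
  is "\<lambda>x y. Poly_Mapping.single (x, y) 1" .

definition free_lift ::
    "('a::complex_vector \<Rightarrow> 'b::complex_vector \<Rightarrow> 'c::complex_vector) \<Rightarrow> (('a \<times> 'b) \<Rightarrow>\<^sub>0 complex) \<Rightarrow> 'c" where
  "free_lift f u = (\<Sum>(x, y) \<in> Poly_Mapping.keys u. Poly_Mapping.lookup u (x, y) *\<^sub>C f x y)"

text \<open>\<open>tensor_lift f\<close> is the linear map induced by \<open>f\<close>; it is meaningful for bilinear \<open>f\<close> only,
  by the universal property \<open>tensor_lift_tensor\<close>, \<open>clinear_tensor_lift\<close>, \<open>tensor_ext\<close> below.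
  Sweedler notation is rendered as \<open>tensor_lift (\<lambda>x\<^sub>1 x\<^sub>2. \<dots>) (\<Delta> x)\<close>.\<close>

definition tensor_lift ::
    "('a::complex_vector \<Rightarrow> 'b::complex_vector \<Rightarrow> 'c::complex_vector) \<Rightarrow> ('a, 'b) tensor \<Rightarrow> 'c" where
  "tensor_lift f t = free_lift f (rep_tensor t)"

lemma free_lift_superset:
  assumes "finite A" "Poly_Mapping.keys u \<subseteq> A"
  shows "free_lift f u = (\<Sum>(x, y) \<in> A. Poly_Mapping.lookup u (x, y) *\<^sub>C f x y)"
  unfolding free_lift_def
  by (rule sum.mono_neutral_left) (use assms in \<open>auto simp: in_keys_iff\<close>)

lemma clinear_free_lift: "clinear (free_lift f)"
  unfolding clinear_iff
proof (intro conjI allI)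
  fix u v :: "('a \<times> 'b) \<Rightarrow>\<^sub>0 complex" and c :: complex
  let ?A = "Poly_Mapping.keys u \<union> Poly_Mapping.keys v"
  have "free_lift f (u + v) = (\<Sum>(x, y) \<in> ?A. Poly_Mapping.lookup (u + v) (x, y) *\<^sub>C f x y)"
    by (rule free_lift_superset) (simp_all add: Poly_Mapping.keys_add)
  then show "free_lift f (u + v) = free_lift f u + free_lift f v"
    by (simp add: free_lift_superset[of ?A] lookup_add scaleC_add_left sum.distrib split_def)
  have "Poly_Mapping.keys (c *\<^sub>C u) \<subseteq> Poly_Mapping.keys u"
    by (auto simp: in_keys_iff scaleC_poly_mapping.rep_eq)
  then have "free_lift f (c *\<^sub>C u) =
      (\<Sum>(x, y) \<in> Poly_Mapping.keys u. Poly_Mapping.lookup (c *\<^sub>C u) (x, y) *\<^sub>C f x y)"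
    by (intro free_lift_superset) simp_all
  then show "free_lift f (c *\<^sub>C u) = c *\<^sub>C free_lift f u"
    by (simp add: free_lift_def scaleC_poly_mapping.rep_eq complex_vector.scale_sum_right
        split_def scaleC_scaleC scaleC_complex_def)
qed

lemma free_lift_single: "free_lift f (Poly_Mapping.single (x, y) c) = c *\<^sub>C f x y"
  by (simp add: free_lift_def)

lemma free_lift_relations:
  assumes "cbilinear f" "u \<in> complex_vector.span tensor_relations"
  shows "free_lift f u = 0"
proof -
  interpret L: Vector_Spaces.linear scaleC scaleC "free_lift f" by (rule clinear_free_lift)
  have b: "f (x + x') y = f x y + f x' y" "f x (y + y') = f x y + f x y'"
    "f (c *\<^sub>C x) y = c *\<^sub>C f x y" "f x (c *\<^sub>C y) = c *\<^sub>C f x y" for x x' y y' c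
    using assms(1) by (auto simp: cbilinear_def clinear_iff)
  have "free_lift f r = 0" if "r \<in> tensor_relations" for r
    using that
    by (auto simp: tensor_relations_def L.diff L.scale free_lift_single b
        scaleC_scaleC scaleC_one)
  then show ?thesis
    using L.eq_0_on_span assms(2) by blast
qed

lemma free_lift_cong:
  assumes "cbilinear f" "tensor_eq u v"
  shows "free_lift f u = free_lift f v"
proof -
  interpret L: Vector_Spaces.linear scaleC scaleC "free_lift f" by (rule clinear_free_lift)
  show ?thesis
    using free_lift_relations[of f "u - v"] assms by (simp add: tensor_eq_def L.diff)
qed

lemma tensor_lift_abs: "cbilinear f \<Longrightarrow> tensor_lift f (abs_tensor u) = free_lift f u"
  unfolding tensor_lift_def
  by (rule free_lift_cong) (simp_all add: Quotient3_tensor rep_abs_rsp_left equivp_reflp tensor_equivp)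

lemma tensor_lift_tensor: "cbilinear f \<Longrightarrow> tensor_lift f (x \<otimes> y) = f x y"
  by (simp add: tensor.abs_eq tensor_lift_abs free_lift_single scaleC_one)

lemma clinear_tensor_lift:
  assumes "cbilinear f" shows "clinear (tensor_lift f)"
proof -
  interpret L: Vector_Spaces.linear scaleC scaleC "free_lift f" by (rule clinear_free_lift)
  have "tensor_lift f (s + t) = tensor_lift f s + tensor_lift f t" for s t
    by (induct s; induct t) (simp add: plus_tensor.abs_eq tensor_lift_abs assms L.add)
  moreover have "tensor_lift f (c *\<^sub>C t) = c *\<^sub>C tensor_lift f t" for c t
    by (induct t) (simp add: scaleC_tensor.abs_eq tensor_lift_abs assms L.scale)
  ultimately show ?thesis by (simp add: clinear_iff)
qed

lemma cbilinear_tensor: "cbilinear (\<otimes>)"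
proof -
  have abs_eqI: "abs_tensor u = abs_tensor v" if "u - v \<in> tensor_relations"
    for u v :: "('a \<times> 'b) \<Rightarrow>\<^sub>0 complex"
    using complex_vector.span_base[OF that] by (simp add: tensor.abs_eq_iff tensor_eq_def)
  have "(x + x') \<otimes> y = x \<otimes> y + x' \<otimes> y" for x x' :: 'a and y :: 'b
    unfolding tensor.abs_eq plus_tensor.abs_eq
    by (rule abs_eqI) (unfold tensor_relations_def diff_diff_eq[symmetric], blast)
  moreover have "x \<otimes> (y + y') = x \<otimes> y + x \<otimes> y'" for x :: 'a and y y' :: 'b
    unfolding tensor.abs_eq plus_tensor.abs_eq
    by (rule abs_eqI) (unfold tensor_relations_def diff_diff_eq[symmetric], blast)
  moreover have "(c *\<^sub>C x) \<otimes> y = c *\<^sub>C (x \<otimes> y)" for c and x :: 'a and y :: 'b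
    unfolding tensor.abs_eq scaleC_tensor.abs_eq
    by (rule abs_eqI) (unfold tensor_relations_def, blast)
  moreover have "x \<otimes> (c *\<^sub>C y) = c *\<^sub>C (x \<otimes> y)" for c and x :: 'a and y :: 'b
    unfolding tensor.abs_eq scaleC_tensor.abs_eq
    by (rule abs_eqI) (unfold tensor_relations_def, blast)
  ultimately show ?thesis by (simp add: cbilinear_def clinear_iff)
qed

lemma tensor_ext:
  assumes "clinear f" "clinear g" "\<And>x y. f (x \<otimes> y) = g (x \<otimes> y)"
  shows "f t = g t"
proof -
  interpret f: Vector_Spaces.linear scaleC scaleC f by fact
  interpret g: Vector_Spaces.linear scaleC scaleC g by fact
  have single: "abs_tensor (Poly_Mapping.single p c) = c *\<^sub>C (fst p \<otimes> snd p)" for p :: "'a \<times> 'b" and c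
  proof -
    have "Poly_Mapping.single p c = c *\<^sub>C Poly_Mapping.single p 1"
      by (rule poly_mapping_eqI)
        (simp add: scaleC_poly_mapping.rep_eq lookup_single when_def scaleC_complex_def)
    then show ?thesis by (simp add: tensor.abs_eq scaleC_tensor.abs_eq)
  qed
  have "f (abs_tensor u) = g (abs_tensor u)" for u
  proof (induct u rule: update_induct)
    case const
    show ?case by (simp add: zero_tensor.abs_eq[symmetric] f.zero g.zero)
  next
    case (update u k c)
    have "Poly_Mapping.update k c u = u + Poly_Mapping.single k c"
      using update by (intro poly_mapping_eqI)
        (auto simp: lookup_update lookup_add lookup_single when_def in_keys_iff)
    then show ?case
      using update by (simp add: plus_tensor.abs_eq[symmetric] f.add g.add single f.scale g.scale assms(3))
  qed
  then show ?thesis by (induct t) simp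
qed

definition tensor_map :: "('a::complex_vector \<Rightarrow> 'c::complex_vector) \<Rightarrow> ('b::complex_vector \<Rightarrow> 'd::complex_vector)
    \<Rightarrow> ('a, 'b) tensor \<Rightarrow> ('c, 'd) tensor" where
  "tensor_map f g = tensor_lift (\<lambda>x y. f x \<otimes> g y)"

definition tensor_assoc :: "(('a::complex_vector, 'b::complex_vector) tensor, 'c::complex_vector) tensor
    \<Rightarrow> ('a, ('b, 'c) tensor) tensor" where
  "tensor_assoc = tensor_lift (\<lambda>s z. tensor_lift (\<lambda>x y. x \<otimes> (y \<otimes> z)) s)"

definition tensor_flip :: "('a::complex_vector, 'b::complex_vector) tensor \<Rightarrow> ('b, 'a) tensor" where
  "tensor_flip = tensor_lift (\<lambda>x y. y \<otimes> x)"


section \<open>Algebras, bialgebras, Hopf algebras\<close>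

record 'a alg =
  alg_mult :: "'a \<Rightarrow> 'a \<Rightarrow> 'a"
  alg_one :: 'a

record (overloaded) 'a bialg = "'a alg" +
  comult :: "'a \<Rightarrow> ('a, 'a) tensor"
  counit :: "'a \<Rightarrow> complex"

definition algebra :: "('a::complex_vector, 'z) alg_scheme \<Rightarrow> bool" where
  "algebra A \<longleftrightarrow> cbilinear (alg_mult A)
     \<and> (\<forall>x y z. alg_mult A (alg_mult A x y) z = alg_mult A x (alg_mult A y z))
     \<and> (\<forall>x. alg_mult A (alg_one A) x = x \<and> alg_mult A x (alg_one A) = x)"

definition alg_inverse :: "('a, 'z) alg_scheme \<Rightarrow> 'a \<Rightarrow> 'a" where
  "alg_inverse A x = (THE y. alg_mult A x y = alg_one A \<and> alg_mult A y x = alg_one A)"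

definition character :: "('a::complex_vector, 'z) alg_scheme \<Rightarrow> ('a \<Rightarrow> complex) \<Rightarrow> bool" where
  "character A \<chi> \<longleftrightarrow> clinear \<chi>
     \<and> (\<forall>x y. \<chi> (alg_mult A x y) = \<chi> x * \<chi> y) \<and> \<chi> (alg_one A) = 1"

definition tensor_alg :: "('a::complex_vector, 'y) alg_scheme \<Rightarrow> ('b::complex_vector, 'z) alg_scheme
    \<Rightarrow> ('a, 'b) tensor alg" where
  "tensor_alg A B =
     \<lparr>alg_mult = \<lambda>s t. tensor_lift (\<lambda>x y. tensor_lift (\<lambda>x' y'. alg_mult A x x' \<otimes> alg_mult B y y') t) s,
      alg_one = alg_one A \<otimes> alg_one B\<rparr>"

definition coalgebra :: "('a::complex_vector, 'z) bialg_scheme \<Rightarrow> bool" where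
  "coalgebra A \<longleftrightarrow> clinear (comult A) \<and> clinear (counit A)
     \<and> (\<forall>x. tensor_assoc (tensor_map (comult A) id (comult A x)) = tensor_map id (comult A) (comult A x))
     \<and> (\<forall>x. tensor_lift (\<lambda>x\<^sub>1 x\<^sub>2. counit A x\<^sub>1 *\<^sub>C x\<^sub>2) (comult A x) = x)
     \<and> (\<forall>x. tensor_lift (\<lambda>x\<^sub>1 x\<^sub>2. counit A x\<^sub>2 *\<^sub>C x\<^sub>1) (comult A x) = x)"

definition bialgebra :: "('a::complex_vector, 'z) bialg_scheme \<Rightarrow> bool" where
  "bialgebra A \<longleftrightarrow> algebra A \<and> coalgebra A
     \<and> (\<forall>x y. comult A (alg_mult A x y) = alg_mult (tensor_alg A A) (comult A x) (comult A y))
     \<and> comult A (alg_one A) = alg_one A \<otimes> alg_one A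
     \<and> (\<forall>x y. counit A (alg_mult A x y) = counit A x * counit A y)
     \<and> counit A (alg_one A) = 1"

definition antipode :: "('a::complex_vector, 'z) bialg_scheme \<Rightarrow> ('a \<Rightarrow> 'a) \<Rightarrow> bool" where
  "antipode A S \<longleftrightarrow> clinear S
     \<and> (\<forall>x. tensor_lift (\<lambda>x\<^sub>1 x\<^sub>2. alg_mult A (S x\<^sub>1) x\<^sub>2) (comult A x) = counit A x *\<^sub>C alg_one A)
     \<and> (\<forall>x. tensor_lift (\<lambda>x\<^sub>1 x\<^sub>2. alg_mult A x\<^sub>1 (S x\<^sub>2)) (comult A x) = counit A x *\<^sub>C alg_one A)"

definition coalgebra_hom :: "('a::complex_vector, 'y) bialg_scheme \<Rightarrow> ('b::complex_vector, 'z) bialg_scheme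
    \<Rightarrow> ('a \<Rightarrow> 'b) \<Rightarrow> bool" where
  "coalgebra_hom A B f \<longleftrightarrow> clinear f
     \<and> (\<forall>x. comult B (f x) = tensor_map f f (comult A x))
     \<and> (\<forall>x. counit B (f x) = counit A x)"

definition bialgebra_hom :: "('a::complex_vector, 'y) bialg_scheme \<Rightarrow> ('b::complex_vector, 'z) bialg_scheme
    \<Rightarrow> ('a \<Rightarrow> 'b) \<Rightarrow> bool" where
  "bialgebra_hom A B f \<longleftrightarrow> coalgebra_hom A B f
     \<and> (\<forall>x y. f (alg_mult A x y) = alg_mult B (f x) (f y)) \<and> f (alg_one A) = alg_one B"


section \<open>Duals\<close>

typedef (overloaded) 'a dual = "{f :: 'a::complex_vector \<Rightarrow> complex. clinear f}"
  morphisms pairing Dual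
  by (rule exI[of _ "\<lambda>_. 0"]) (simp add: clinear_iff)

setup_lifting type_definition_dual

instantiation dual :: (complex_vector) complex_vector
begin
lift_definition zero_dual :: "'a dual" is "\<lambda>_. 0"
  by (simp add: clinear_iff)
lift_definition plus_dual :: "'a dual \<Rightarrow> 'a dual \<Rightarrow> 'a dual" is "\<lambda>f g x. f x + g x"
  by (simp add: clinear_iff scaleC_add_right)
lift_definition minus_dual :: "'a dual \<Rightarrow> 'a dual \<Rightarrow> 'a dual" is "\<lambda>f g x. f x - g x"
  by (simp add: clinear_iff complex_vector.scale_right_diff_distrib)
lift_definition uminus_dual :: "'a dual \<Rightarrow> 'a dual" is "\<lambda>f x. - f x"
  by (simp add: clinear_iff)
lift_definition scaleC_dual :: "complex \<Rightarrow> 'a dual \<Rightarrow> 'a dual" is "\<lambda>c f x. c * f x"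
  by (simp add: clinear_iff scaleC_complex_def algebra_simps)
instance
  by standard (transfer, simp add: fun_eq_iff algebra_simps)+
end

text \<open>The algebra dual to a coalgebra, under the pairing
  \<open>\<langle>f \<otimes> g, x \<otimes> y\<rangle> = \<langle>f, x\<rangle> \<langle>g, y\<rangle>\<close>.\<close>

definition dual_alg :: "('a::complex_vector, 'z) bialg_scheme \<Rightarrow> 'a dual alg" where
  "dual_alg A =
     \<lparr>alg_mult = \<lambda>f g. Dual (\<lambda>x. tensor_lift (\<lambda>x\<^sub>1 x\<^sub>2. pairing f x\<^sub>1 * pairing g x\<^sub>2) (comult A x)),
      alg_one = Dual (counit A)\<rparr>"

text \<open>The coproduct dual to the product; for finite-dimensional \<open>A\<close> such a \<open>t\<close> exists and is unique.\<close>

definition dual_comult :: "('a::complex_vector, 'z) alg_scheme \<Rightarrow> 'a dual \<Rightarrow> ('a dual, 'a dual) tensor" where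
  "dual_comult A f = (THE t. \<forall>x y.
     tensor_lift (\<lambda>f\<^sub>1 f\<^sub>2. pairing f\<^sub>1 x * pairing f\<^sub>2 y) t = pairing f (alg_mult A x y))"

definition dual_bialg :: "('a::complex_vector, 'z) bialg_scheme \<Rightarrow> 'a dual bialg" where
  "dual_bialg A =
     \<lparr>alg_mult = alg_mult (dual_alg A), alg_one = alg_one (dual_alg A),
      comult = dual_comult A, counit = (\<lambda>f. pairing f (alg_one A))\<rparr>"

definition co_opposite :: "('a::complex_vector, 'z) bialg_scheme \<Rightarrow> ('a, 'z) bialg_scheme" where
  "co_opposite A = A\<lparr>comult := \<lambda>x. tensor_flip (comult A x)\<rparr>"


section \<open>The quantum double\<close>

type_synonym 'a double = "('a, 'a dual) tensor"

definition H_minus :: "('a::complex_vector, 'z) bialg_scheme \<Rightarrow> 'a dual bialg" where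
  "H_minus A = co_opposite (dual_bialg A)"

definition incl_plus :: "('a::complex_vector, 'z) bialg_scheme \<Rightarrow> 'a \<Rightarrow> 'a double" where
  "incl_plus A x = x \<otimes> alg_one (H_minus A)"

definition incl_minus :: "('a::complex_vector, 'z) bialg_scheme \<Rightarrow> 'a dual \<Rightarrow> 'a double" where
  "incl_minus A \<xi> = alg_one A \<otimes> \<xi>"

text \<open>The conditions below determine the bialgebra structure \<open>D\<close> on \<open>H\<^sub>+ \<otimes> H\<^sub>-\<close> uniquely when
  \<open>H\<^sub>+\<close> is a finite-dimensional Hopf algebra with invertible antipode, so \<open>quantum_double H\<^sub>+ D\<close> reads \<open>D = D(H\<^sub>+)\<close>;
  the antipode of \<open>D\<close> is then automatic.\<close>

definition quantum_double :: "('a::complex_vector, 'z) bialg_scheme \<Rightarrow> 'a double bialg \<Rightarrow> bool" where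
  "quantum_double A D \<longleftrightarrow> bialgebra D
     \<and> (\<forall>h x \<xi>. alg_mult D (incl_plus A h) (x \<otimes> \<xi>) = alg_mult A h x \<otimes> \<xi>)
     \<and> (\<forall>x \<xi> \<eta>. alg_mult D (x \<otimes> \<xi>) (incl_minus A \<eta>) = x \<otimes> alg_mult (H_minus A) \<xi> \<eta>)
     \<and> bialgebra_hom A D (incl_plus A)
     \<and> bialgebra_hom (H_minus A) D (incl_minus A)
     \<and> (\<forall>\<xi> x.
          tensor_lift (\<lambda>\<xi>\<^sub>1 \<xi>\<^sub>2. tensor_lift (\<lambda>x\<^sub>1 x\<^sub>2.
              pairing \<xi>\<^sub>1 x\<^sub>1 *\<^sub>C alg_mult D (incl_minus A \<xi>\<^sub>2) (incl_plus A x\<^sub>2))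
            (comult A x)) (comult (H_minus A) \<xi>)
        = tensor_lift (\<lambda>\<xi>\<^sub>1 \<xi>\<^sub>2. tensor_lift (\<lambda>x\<^sub>1 x\<^sub>2.
              pairing \<xi>\<^sub>2 x\<^sub>2 *\<^sub>C alg_mult D (incl_plus A x\<^sub>1) (incl_minus A \<xi>\<^sub>1))
            (comult A x)) (comult (H_minus A) \<xi>))"

definition finite_basis :: "'a::complex_vector set \<Rightarrow> bool" where
  "finite_basis B \<longleftrightarrow> finite B \<and> complex_vector.independent B \<and> complex_vector.span B = UNIV"

text \<open>The element of the basis dual to \<open>B\<close> that corresponds to \<open>b \<in> B\<close>.\<close>

definition dual_vector :: "'a::complex_vector set \<Rightarrow> 'a \<Rightarrow> 'a dual" where
  "dual_vector B b = Dual (\<lambda>x. complex_vector.representation B x b)"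

definition universal_R ::
    "('a::complex_vector, 'z) bialg_scheme \<Rightarrow> 'a double bialg \<Rightarrow> 'a set \<Rightarrow> ('a double, 'a double) tensor" where
  "universal_R A D B = alg_inverse (tensor_alg D D)
     (\<Sum>b\<in>B. incl_minus A (dual_vector B b) \<otimes> incl_plus A b)"


section \<open>The reflection equation dual\<close>

definition involution :: "('h::complex_vector, 'z) bialg_scheme \<Rightarrow> ('h \<Rightarrow> 'h) \<Rightarrow> bool" where
  "involution H \<tau> \<longleftrightarrow> coalgebra_hom H H \<tau> \<and> (\<forall>x. \<tau> (\<tau> x) = x)
     \<and> (\<forall>x y. \<tau> (alg_mult H x y) = alg_mult H (\<tau> y) (\<tau> x)) \<and> \<tau> (alg_one H) = alg_one H"

definition left_act :: "('h::complex_vector, 'z) alg_scheme \<Rightarrow> 'h \<Rightarrow> 'h dual \<Rightarrow> 'h dual" where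
  "left_act H h a = Dual (\<lambda>x. pairing a (alg_mult H x h))"

definition right_act :: "('h::complex_vector, 'z) alg_scheme \<Rightarrow> 'h dual \<Rightarrow> 'h \<Rightarrow> 'h dual" where
  "right_act H a h = Dual (\<lambda>x. pairing a (alg_mult H h x))"

text \<open>The unit of the twisted product is that of \<open>H\<^sup>*\<close>, i.e. the counit of \<open>H\<close>.\<close>

definition RE_dual :: "('h::complex_vector, 'z) bialg_scheme \<Rightarrow> ('h \<Rightarrow> 'h) \<Rightarrow> ('h, 'h) tensor \<Rightarrow> 'h dual alg" where
  "RE_dual H \<tau> R =
     \<lparr>alg_mult = \<lambda>a b. tensor_lift (\<lambda>r\<^sub>1 r\<^sub>2.
        alg_mult (dual_alg H) (left_act H (\<tau> r\<^sub>1) a) (right_act H b r\<^sub>2))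
        (alg_inverse (tensor_alg H H) R),
      alg_one = alg_one (dual_alg H)\<rparr>"

end

theory Submission
  imports Defs
begin

text \<open>
  A character of the RE dual is evaluation at an element \<open>K\<close> of \<open>H = H\<^sub>+ \<otimes> H\<^sub>+\<^sup>*\<close>, and
  multiplicativity says \<open>\<Sum>\<^sub>\<mu> K\<^sub>1 \<tau>(e\<^sup>\<mu>) \<otimes> e\<^sub>\<mu> K\<^sub>2 = K \<otimes> K\<close>. Since \<open>\<tau>\<close> preserves \<open>H\<^sub>-\<close>, the
  transpose \<open>\<sigma>\<close> of its restriction is an involution of \<open>H\<^sub>+\<close>. Reading \<open>K\<close> as a linear map
  \<open>k\<close> on \<open>H\<^sub>+\<close>, the equation needs no reordering of the two factors of \<open>H\<close>:
  \<open>k(z y\<^sub>1)\<^sub>1 \<otimes> \<sigma>(y\<^sub>2) k(z y\<^sub>1)\<^sub>2 = k(y) \<otimes> k(z)\<close> for all \<open>y, z\<close>. Applying the counit to the second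
  factor gives \<open>k(y) = \<phi>(y) G\<close> with \<open>\<phi>\<close> antimultiplicative, and \<open>y = z = 1\<close> shows that \<open>G\<close> is
  grouplike. Cancelling \<open>G\<close> and then the convolution-invertible \<open>\<phi>\<close> leaves \<open>\<sigma>(y) = \<epsilon>(y) 1\<close>, and
  \<open>\<sigma>\<close> is bijective.
\<close>

section \<open>Linear maps and tensors\<close>

lemma clinearI:
  "(\<And>x y. f (x + y) = f x + f y) \<Longrightarrow> (\<And>c x. f (c *\<^sub>C x) = c *\<^sub>C f x) \<Longrightarrow> clinear f"
  by (simp add: clinear_iff)

lemma clinear_add: "clinear f \<Longrightarrow> f (x + y) = f x + f y"
  by (simp add: clinear_iff)

lemma clinear_scaleC: "clinear f \<Longrightarrow> f (c *\<^sub>C x) = c *\<^sub>C f x"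
  by (simp add: clinear_iff)

lemma clinear_zero: "clinear f \<Longrightarrow> f 0 = 0"
  using clinear_scaleC[of f 0 0] by simp

lemma clinear_sum: "clinear f \<Longrightarrow> f (\<Sum>i\<in>I. x i) = (\<Sum>i\<in>I. f (x i))"
  by (induct I rule: infinite_finite_induct) (simp_all add: clinear_zero clinear_add)

lemma cbilinearI:
  assumes "\<And>x x' y. f (x + x') y = f x y + f x' y" "\<And>c x y. f (c *\<^sub>C x) y = c *\<^sub>C f x y"
    and "\<And>x y y'. f x (y + y') = f x y + f x y'" "\<And>c x y. f x (c *\<^sub>C y) = c *\<^sub>C f x y"
  shows "cbilinear f"
  using assms by (simp add: cbilinear_def clinear_iff)

lemma cbilinear_simps:
  assumes "cbilinear f"
  shows "f (x + x') y = f x y + f x' y" "f (c *\<^sub>C x) y = c *\<^sub>C f x y"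
    and "f x (y + y') = f x y + f x y'" "f x (c *\<^sub>C y) = c *\<^sub>C f x y"
  using assms by (simp_all add: cbilinear_def clinear_iff)

lemma cbilinear_sum:
  assumes "cbilinear f"
  shows "f (\<Sum>i\<in>I. u i) y = (\<Sum>i\<in>I. f (u i) y)" "f x (\<Sum>i\<in>I. v i) = (\<Sum>i\<in>I. f x (v i))"
  using assms clinear_sum[of "\<lambda>x. f x y" u I] clinear_sum[of "f x" v I]
  by (simp_all add: cbilinear_def)

lemmas tensor_bilinear [simp] = cbilinear_simps[OF cbilinear_tensor]
lemmas scaleC_distribs = scaleC_add_right scaleC_add_left scaleC_scaleC scaleC_one scaleC_complex_def

text \<open>\<open>tensor_lift f t\<close> is a finite weighted sum over one fixed representative of
  \<open>t\<close>, so every linear map passes through it, whatever \<open>f\<close> is. The next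
  few rules for Sweedler sums rest on the same observation.\<close>

lemma clinear_tensor_lift_apply:
  "clinear L \<Longrightarrow> L (tensor_lift f t) = tensor_lift (\<lambda>x y. L (f x y)) t"
  by (simp add: tensor_lift_def free_lift_def clinear_sum clinear_scaleC split_def)

lemma tensor_lift_fun_simps [simp]:
  "tensor_lift (\<lambda>x y. f x y + g x y) t = tensor_lift f t + tensor_lift g t"
  "tensor_lift (\<lambda>x y. c *\<^sub>C f x y) t = c *\<^sub>C tensor_lift f t"
  "tensor_lift (\<lambda>x y. c * h x y) t = c * tensor_lift h t"
  "tensor_lift (\<lambda>x y. h x y * c) t = tensor_lift h t * c"
  by (simp_all add: tensor_lift_def free_lift_def split_def scaleC_distribs sum.distrib
      complex_vector.scale_sum_right sum_distrib_left sum_distrib_right mult_ac)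

lemma tensor_lift_fun_sum:
  "tensor_lift (\<lambda>x y. \<Sum>i\<in>I. f i x y) t = (\<Sum>i\<in>I. tensor_lift (f i) t)"
  unfolding tensor_lift_def free_lift_def split_def complex_vector.scale_sum_right
  by (rule sum.swap)

lemma tensor_lift_fun_scaleC_const:
  "tensor_lift (\<lambda>x y. h x y *\<^sub>C v) t = tensor_lift h t *\<^sub>C v"
  by (simp add: tensor_lift_def free_lift_def split_def scaleC_distribs
      complex_vector.scale_sum_left)

lemma tensor_lift_swap:
  "tensor_lift (\<lambda>x y. tensor_lift (f x y) t) s = tensor_lift (\<lambda>x' y'. tensor_lift (\<lambda>x y. f x y x' y') s) t"
  unfolding tensor_lift_def free_lift_def split_def complex_vector.scale_sum_right
  by (subst sum.swap) (simp add: scaleC_scaleC mult.commute)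

text \<open>In the tensor argument linearity does rely on bilinearity of \<open>f\<close>: the
  representative chosen for a sum need not be the sum of the chosen representatives.\<close>

lemma tensor_lift_simps:
  assumes "cbilinear f"
  shows "tensor_lift f (s + t) = tensor_lift f s + tensor_lift f t"
    and "tensor_lift f (c *\<^sub>C t) = c *\<^sub>C tensor_lift f t"
  using clinear_tensor_lift[OF assms] by (simp_all add: clinear_iff)

lemma tensor_lift_tensor_lift:
  assumes "cbilinear h"
  shows "tensor_lift h (tensor_lift f t) = tensor_lift (\<lambda>x y. tensor_lift h (f x y)) t"
  by (rule clinear_tensor_lift_apply) (rule clinear_tensor_lift[OF assms])

lemma tensor_lift_map:
  assumes "cbilinear h"
  shows "tensor_lift h (tensor_map f g t) = tensor_lift (\<lambda>x y. h (f x) (g y)) t"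
  unfolding tensor_map_def by (simp add: tensor_lift_tensor_lift tensor_lift_tensor assms)

lemma tensor_lift_flip:
  assumes "cbilinear h"
  shows "tensor_lift h (tensor_flip t) = tensor_lift (\<lambda>x y. h y x) t"
  unfolding tensor_flip_def by (simp add: tensor_lift_tensor_lift tensor_lift_tensor assms)

lemma tensor_lift_assoc:
  assumes "cbilinear h"
  shows "tensor_lift h (tensor_assoc t) = tensor_lift (\<lambda>s z. tensor_lift (\<lambda>x y. h x (y \<otimes> z)) s) t"
  unfolding tensor_assoc_def by (simp add: tensor_lift_tensor_lift tensor_lift_tensor assms)

lemma tensor_lift_mult:
  assumes "cbilinear h"
  shows "tensor_lift h (alg_mult (tensor_alg A B) s t) =
    tensor_lift (\<lambda>x y. tensor_lift (\<lambda>x' y'. h (alg_mult A x x') (alg_mult B y y')) t) s"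
  unfolding tensor_alg_def by (simp add: tensor_lift_tensor_lift tensor_lift_tensor assms)

text \<open>Lets a formula for pure tensors be summed to a formula for an arbitrary tensor.\<close>

lemma tensor_lift_id: "tensor_lift (\<otimes>) t = t"
proof (rule tensor_ext)
  show "clinear (tensor_lift (\<otimes>))" by (simp add: clinear_tensor_lift cbilinear_tensor)
  show "clinear (\<lambda>t. t)" by (simp add: clinear_iff)
qed (simp add: tensor_lift_tensor cbilinear_tensor)


section \<open>Algebras and their tensor products\<close>

lemma algebra_bilinear:
  assumes "algebra A"
  shows "alg_mult A (x + x') y = alg_mult A x y + alg_mult A x' y"
    and "alg_mult A (c *\<^sub>C x) y = c *\<^sub>C alg_mult A x y"
    and "alg_mult A x (y + y') = alg_mult A x y + alg_mult A x y'"
    and "alg_mult A x (c *\<^sub>C y) = c *\<^sub>C alg_mult A x y"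
  using assms by (simp_all add: algebra_def cbilinear_simps)

lemma algebra_assoc: "algebra A \<Longrightarrow> alg_mult A (alg_mult A x y) z = alg_mult A x (alg_mult A y z)"
  by (simp add: algebra_def)

lemma algebra_one: 
  assumes "algebra A"
  shows "alg_mult A (alg_one A) x = x" "alg_mult A x (alg_one A) = x"
  using assms by (simp_all add: algebra_def)

lemma algebra_tensor_alg:
  assumes A: "algebra A" and B: "algebra B"
  shows "algebra (tensor_alg A B)"
proof -
  let ?M = "alg_mult (tensor_alg A B)"
  have bil: "cbilinear (\<lambda>x' y'. alg_mult A x x' \<otimes> alg_mult B y y')" for x y
    by (rule cbilinearI) (simp_all add: algebra_bilinear[OF A] algebra_bilinear[OF B])
  have bil2: "cbilinear (\<lambda>x y. tensor_lift (\<lambda>x' y'. alg_mult A x x' \<otimes> alg_mult B y y') t)" for t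
    by (rule cbilinearI) (simp_all add: algebra_bilinear[OF A] algebra_bilinear[OF B])
  have M: "?M s t = tensor_lift (\<lambda>x y. tensor_lift (\<lambda>x' y'. alg_mult A x x' \<otimes> alg_mult B y y') t) s" for s t
    by (simp add: tensor_alg_def)
  have "?M (?M s t) u = ?M s (?M t u)" for s t u
    \<comment> \<open>The product \<open>?M s t\<close> on the left stays folded, so that
      \<open>tensor_lift_mult\<close> can evaluate the lift applied to it.\<close>
    unfolding M[of _ u] M[of s "tensor_lift _ _"]
    by (simp add: tensor_lift_mult bil2 bil tensor_lift_tensor_lift tensor_lift_tensor
        algebra_assoc[OF A] algebra_assoc[OF B])
  moreover have "cbilinear ?M"
    unfolding M by (rule cbilinearI) (simp_all add: tensor_lift_simps bil bil2)
  ultimately show ?thesis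
    unfolding algebra_def
    by (simp add: M) (simp add: tensor_alg_def tensor_lift_tensor bil bil2 algebra_one[OF A] algebra_one[OF B] tensor_lift_id)
qed

text \<open>Two-sided inverses are unique in an associative unital algebra, so the definite
  description in \<open>alg_inverse\<close> denotes any inverse that can be exhibited.\<close>

lemma alg_inverse_eqI:
  assumes "algebra A" "alg_mult A x y = alg_one A" "alg_mult A y x = alg_one A"
  shows "alg_inverse A x = y"
  unfolding alg_inverse_def
proof (rule the_equality)
  show "alg_mult A x y = alg_one A \<and> alg_mult A y x = alg_one A" using assms by simp
  fix z assume "alg_mult A x z = alg_one A \<and> alg_mult A z x = alg_one A"
  then show "z = y" using assms by (metis algebra_assoc algebra_one)
qed


section \<open>Duals\<close>

lemma clinear_pairing: "clinear (pairing f)"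
  using pairing[of f] by simp

lemma pairing_simps [simp]:
  "pairing f (x + y) = pairing f x + pairing f y"
  "pairing f (c *\<^sub>C x) = c * pairing f x"
  "pairing (f + g) x = pairing f x + pairing g x"
  "pairing (c *\<^sub>C f) x = c * pairing f x"
  using clinear_pairing[of f]
  by (simp_all add: clinear_iff scaleC_complex_def plus_dual.rep_eq scaleC_dual.rep_eq)

lemma clinear_pairing_left: "clinear (\<lambda>f. pairing f x)"
  by (rule clinearI) (simp_all add: scaleC_complex_def)

lemma pairing_Dual [simp]: "clinear f \<Longrightarrow> pairing (Dual f) x = f x"
  by (simp add: Dual_inverse)

lemma dual_eqI: "(\<And>x. pairing f x = pairing g x) \<Longrightarrow> f = g"
  by (simp add: pairing_inject[symmetric] fun_eq_iff)

text \<open>\<open>Dual\<close> is unspecified outside the linear functionals, so the convolution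
  must be seen to be linear in \<open>x\<close> before it can be evaluated; linearity of the
  coproduct provides this.\<close>

lemma pairing_dual_mult:
  assumes "clinear (comult A)"
  shows "pairing (alg_mult (dual_alg A) f g) x =
    tensor_lift (\<lambda>x\<^sub>1 x\<^sub>2. pairing f x\<^sub>1 * pairing g x\<^sub>2) (comult A x)"
proof -
  have "cbilinear (\<lambda>x\<^sub>1 x\<^sub>2. pairing f x\<^sub>1 * pairing g x\<^sub>2)"
    by (rule cbilinearI) (simp_all add: scaleC_distribs algebra_simps)
  then show ?thesis
    unfolding dual_alg_def
    by (simp, subst pairing_Dual)
       (auto intro!: clinearI simp: tensor_lift_simps clinear_add[OF assms] clinear_scaleC[OF assms])
qed

lemma pairing_dual_one: "clinear (counit A) \<Longrightarrow> pairing (alg_one (dual_alg A)) x = counit A x"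
  by (simp add: dual_alg_def)

lemma pairing_left_act:
  "algebra A \<Longrightarrow> pairing (left_act A h a) x = pairing a (alg_mult A x h)"
  unfolding left_act_def
  by (subst pairing_Dual) (auto intro!: clinearI simp: algebra_bilinear scaleC_complex_def)

lemma pairing_right_act:
  "algebra A \<Longrightarrow> pairing (right_act A a h) x = pairing a (alg_mult A h x)"
  unfolding right_act_def
  by (subst pairing_Dual) (auto intro!: clinearI simp: algebra_bilinear scaleC_complex_def)

section \<open>Dual bases and the coproduct of the dual\<close>

context
  fixes B :: "'a::complex_vector set"
  assumes B: "finite_basis B"
begin

lemma pairing_dual_vector: "pairing (dual_vector B b) x = complex_vector.representation B x b"
proof -
  have "clinear (\<lambda>x. complex_vector.representation B x b)"
    using B by (auto intro!: clinearI simp: finite_basis_def complex_vector.representation_add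
        complex_vector.representation_scale scaleC_complex_def)
  then show ?thesis by (simp add: dual_vector_def)
qed

lemma basis_expansion: "(\<Sum>b\<in>B. pairing (dual_vector B b) x *\<^sub>C b) = x"
  using B complex_vector.sum_representation_eq[of B x B]
  by (simp add: pairing_dual_vector finite_basis_def)

lemma dual_basis_expansion: "(\<Sum>b\<in>B. pairing f b *\<^sub>C dual_vector B b) = f"
proof (rule dual_eqI)
  fix x
  have "pairing f x = pairing f (\<Sum>b\<in>B. pairing (dual_vector B b) x *\<^sub>C b)"
    by (simp add: basis_expansion)
  then show "pairing (\<Sum>b\<in>B. pairing f b *\<^sub>C dual_vector B b) x = pairing f x"
    by (simp add: clinear_sum[OF clinear_pairing] clinear_sum[OF clinear_pairing_left] mult.commute)
qed

lemma eq_by_pairing: "(\<And>f. pairing f x = pairing f y) \<Longrightarrow> x = y" for x y :: 'a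
  by (metis (no_types, lifting) basis_expansion sum.cong)

text \<open>The coefficients of a tensor in the basis of products are its pairings with the dual
  basis. Equalities between tensors thereby reduce to equalities between scalars.\<close>

lemma tensor_lift_expansion:
  assumes "cbilinear h"
  shows "tensor_lift h t = (\<Sum>b\<in>B. \<Sum>c\<in>B.
    tensor_lift (\<lambda>x y. pairing (dual_vector B b) x * pairing (dual_vector B c) y) t *\<^sub>C h b c)"
proof -
  have eq: "h x y = (\<Sum>b\<in>B. \<Sum>c\<in>B. (pairing (dual_vector B b) x * pairing (dual_vector B c) y) *\<^sub>C h b c)" for x y
  proof -
    have "h x y = h (\<Sum>b\<in>B. pairing (dual_vector B b) x *\<^sub>C b) (\<Sum>c\<in>B. pairing (dual_vector B c) y *\<^sub>C c)"
      by (simp add: basis_expansion)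
    then show ?thesis
      by (simp only: cbilinear_sum(1)[OF assms])
        (simp add: cbilinear_sum[OF assms] cbilinear_simps[OF assms] scaleC_scaleC
          complex_vector.scale_sum_right mult.commute)
  qed
  have "tensor_lift h t = tensor_lift (\<lambda>x y. \<Sum>b\<in>B. \<Sum>c\<in>B.
      (pairing (dual_vector B b) x * pairing (dual_vector B c) y) *\<^sub>C h b c) t"
    by (rule arg_cong[of _ _ "\<lambda>k. tensor_lift k t"], intro ext, rule eq)
  then show ?thesis by (simp only: tensor_lift_fun_sum tensor_lift_fun_scaleC_const)
qed

text \<open>A tensor over the dual is determined by its values on pairs of basis vectors; this
  yields the uniqueness behind \<open>dual_comult\<close>.\<close>

lemma dual_tensor_expansion:
  fixes t :: "('a dual, 'a dual) tensor"
  shows "t = (\<Sum>b\<in>B. \<Sum>c\<in>B. tensor_lift (\<lambda>f g. pairing f b * pairing g c) t *\<^sub>C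
    (dual_vector B b \<otimes> dual_vector B c))"
proof -
  have eq: "f \<otimes> g = (\<Sum>b\<in>B. \<Sum>c\<in>B. (pairing f b * pairing g c) *\<^sub>C (dual_vector B b \<otimes> dual_vector B c))" for f g
  proof -
    have "f \<otimes> g = (\<Sum>b\<in>B. pairing f b *\<^sub>C dual_vector B b) \<otimes> (\<Sum>c\<in>B. pairing g c *\<^sub>C dual_vector B c)"
      by (simp add: dual_basis_expansion)
    then show ?thesis
      by (simp only: cbilinear_sum(1)[OF cbilinear_tensor])
        (simp add: cbilinear_sum[OF cbilinear_tensor] scaleC_scaleC
          complex_vector.scale_sum_right mult.commute)
  qed
  have "tensor_lift (\<otimes>) t = tensor_lift (\<lambda>f g. \<Sum>b\<in>B. \<Sum>c\<in>B.
      (pairing f b * pairing g c) *\<^sub>C (dual_vector B b \<otimes> dual_vector B c)) t"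
    by (rule arg_cong[of _ _ "\<lambda>k. tensor_lift k t"], intro ext, rule eq)
  then show ?thesis by (simp only: tensor_lift_fun_sum tensor_lift_fun_scaleC_const tensor_lift_id)
qed

text \<open>The definite description is met by the tensor \<open>t\<close> whose coefficients are
  the values of \<xi> on products of basis vectors; any other candidate has the same expansion in
  the dual basis.\<close>

lemma dual_comult:
  fixes x y :: 'a
  assumes A: "algebra A"
  shows "tensor_lift (\<lambda>f g. pairing f x * pairing g y) (dual_comult A \<xi>) = pairing \<xi> (alg_mult A x y)"
proof -
  have bil: "cbilinear (\<lambda>f g. pairing f x * pairing g y)" for x y :: 'a
    by (rule cbilinearI) (simp_all add: scaleC_distribs algebra_simps)
  have bil': "cbilinear (\<lambda>x y :: 'a. pairing \<xi> (alg_mult A x y))"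
    by (rule cbilinearI) (simp_all add: scaleC_distribs algebra_bilinear[OF A])
  define t where "t = (\<Sum>b\<in>B. \<Sum>c\<in>B. pairing \<xi> (alg_mult A b c) *\<^sub>C (dual_vector B b \<otimes> dual_vector B c))"
  have t: "tensor_lift (\<lambda>f g. pairing f x * pairing g y) t = pairing \<xi> (alg_mult A x y)" for x y
  proof -
    have "pairing \<xi> (alg_mult A x y) = tensor_lift (\<lambda>x y. pairing \<xi> (alg_mult A x y)) (x \<otimes> y)"
      by (simp add: tensor_lift_tensor bil')
    also have "\<dots> = (\<Sum>b\<in>B. \<Sum>c\<in>B. (pairing (dual_vector B b) x * pairing (dual_vector B c) y)
        *\<^sub>C pairing \<xi> (alg_mult A b c))"
      by (subst tensor_lift_expansion[OF bil'], intro sum.cong refl, subst tensor_lift_tensor)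
        (auto intro!: cbilinearI simp: scaleC_distribs algebra_simps)
    finally show ?thesis
      by (simp add: t_def clinear_sum[OF clinear_tensor_lift[OF bil]] tensor_lift_simps[OF bil]
          tensor_lift_tensor bil scaleC_complex_def mult_ac)
  qed
  have "dual_comult A \<xi> = t"
    unfolding dual_comult_def
  proof (rule the_equality)
    fix s assume "\<forall>x y. tensor_lift (\<lambda>f g. pairing f x * pairing g y) s = pairing \<xi> (alg_mult A x y)"
    then show "s = t" by (subst dual_tensor_expansion) (simp add: t_def)
  qed (simp add: t)
  then show ?thesis by (simp add: t)
qed

end


section \<open>Finite-dimensional Hopf algebras\<close>

locale finite_hopf =
  fixes A :: "'a::complex_vector bialg" and S :: "'a \<Rightarrow> 'a" and B :: "'a set"
  assumes bialgebra: "bialgebra A" and antipode: "antipode A S" and basis: "finite_basis B"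
begin

abbreviation mult (infixl "\<bullet>" 70) where "x \<bullet> y \<equiv> alg_mult A x y"
abbreviation one ("\<one>") where "\<one> \<equiv> alg_one A"
abbreviation \<Delta> where "\<Delta> \<equiv> comult A"
abbreviation \<epsilon> where "\<epsilon> \<equiv> counit A"
abbreviation dual_mult (infixl "\<star>" 70) where "f \<star> g \<equiv> alg_mult (dual_alg A) f g"
abbreviation dual_one where "dual_one \<equiv> alg_one (dual_alg A)"

lemma algebra: "algebra A"
  using bialgebra by (simp add: bialgebra_def)

lemmas alg_simps = algebra_bilinear[OF algebra] algebra_one[OF algebra]

lemma clinear_comult: "clinear \<Delta>" and clinear_counit: "clinear \<epsilon>"
  using bialgebra by (simp_all add: bialgebra_def coalgebra_def)

lemma clinear_antipode: "clinear S"
  using antipode by (simp add: antipode_def)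

lemmas lin_simps = clinear_add[OF clinear_comult] clinear_scaleC[OF clinear_comult]
  clinear_add[OF clinear_counit] clinear_scaleC[OF clinear_counit]
  clinear_add[OF clinear_antipode] clinear_scaleC[OF clinear_antipode]

lemma bialg_simps:
  "\<Delta> \<one> = \<one> \<otimes> \<one>" "\<epsilon> \<one> = 1" "\<epsilon> (x \<bullet> y) = \<epsilon> x * \<epsilon> y"
  using bialgebra by (simp_all add: bialgebra_def)

lemma counit_left: "tensor_lift (\<lambda>x\<^sub>1 x\<^sub>2. \<epsilon> x\<^sub>1 *\<^sub>C x\<^sub>2) (\<Delta> x) = x"
  and counit_right: "tensor_lift (\<lambda>x\<^sub>1 x\<^sub>2. \<epsilon> x\<^sub>2 *\<^sub>C x\<^sub>1) (\<Delta> x) = x"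
  using bialgebra by (simp_all add: bialgebra_def coalgebra_def)

lemma counit_left_apply:
  assumes "clinear L" shows "tensor_lift (\<lambda>x\<^sub>1 x\<^sub>2. \<epsilon> x\<^sub>1 *\<^sub>C L x\<^sub>2) (\<Delta> x) = L x"
  using clinear_tensor_lift_apply[OF assms, of "\<lambda>x\<^sub>1 x\<^sub>2. \<epsilon> x\<^sub>1 *\<^sub>C x\<^sub>2" "\<Delta> x"]
  by (simp add: counit_left clinear_scaleC[OF assms])

lemma counit_right_apply:
  assumes "clinear L" shows "tensor_lift (\<lambda>x\<^sub>1 x\<^sub>2. \<epsilon> x\<^sub>2 *\<^sub>C L x\<^sub>1) (\<Delta> x) = L x"
  using clinear_tensor_lift_apply[OF assms, of "\<lambda>x\<^sub>1 x\<^sub>2. \<epsilon> x\<^sub>2 *\<^sub>C x\<^sub>1" "\<Delta> x"]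
  by (simp add: counit_right clinear_scaleC[OF assms])

lemma antipode_left: "tensor_lift (\<lambda>x\<^sub>1 x\<^sub>2. S x\<^sub>1 \<bullet> x\<^sub>2) (\<Delta> x) = \<epsilon> x *\<^sub>C \<one>"
  and antipode_right: "tensor_lift (\<lambda>x\<^sub>1 x\<^sub>2. x\<^sub>1 \<bullet> S x\<^sub>2) (\<Delta> x) = \<epsilon> x *\<^sub>C \<one>"
  using antipode by (simp_all add: antipode_def)

text \<open>The axiom equates two tensors with three factors; applying the map induced by a
  trilinear \<open>h\<close> turns it into an identity of nested Sweedler sums. The assumptions are
  trilinearity in the form that the two nested lifts require.\<close>

lemma coassoc:
  assumes "\<And>x. cbilinear (h x)" and "cbilinear (\<lambda>x s. tensor_lift (h x) s)"
  shows "tensor_lift (\<lambda>s z. tensor_lift (\<lambda>x y. h x y z) (\<Delta> s)) (\<Delta> x) =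
    tensor_lift (\<lambda>x s. tensor_lift (h x) (\<Delta> s)) (\<Delta> x)"
proof -
  have "tensor_lift (\<lambda>x s. tensor_lift (h x) s) (tensor_assoc (tensor_map \<Delta> id (\<Delta> x))) =
      tensor_lift (\<lambda>x s. tensor_lift (h x) s) (tensor_map id \<Delta> (\<Delta> x))"
    using bialgebra by (simp add: bialgebra_def coalgebra_def)
  moreover have "cbilinear (\<lambda>s z. tensor_lift (\<lambda>x y. tensor_lift (h x) (y \<otimes> z)) s)"
    using cbilinear_simps[OF assms(2)]
    by (intro cbilinearI) (simp_all add: tensor_lift_simps cbilinearI)
  ultimately show ?thesis
    by (simp add: tensor_lift_assoc tensor_lift_map tensor_lift_tensor assms)
qed

section \<open>The dual algebra and the right action on it\<close>

lemma pairing_mult: "pairing (f \<star> g) x = tensor_lift (\<lambda>x\<^sub>1 x\<^sub>2. pairing f x\<^sub>1 * pairing g x\<^sub>2) (\<Delta> x)"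
  by (rule pairing_dual_mult[OF clinear_comult])

lemma pairing_one: "pairing dual_one x = \<epsilon> x"
  by (rule pairing_dual_one[OF clinear_counit])

lemma dual_alg_simps:
  "(f + f') \<star> g = f \<star> g + f' \<star> g" "(c *\<^sub>C f) \<star> g = c *\<^sub>C (f \<star> g)"
  "f \<star> (g + g') = f \<star> g + f \<star> g'" "f \<star> (c *\<^sub>C g) = c *\<^sub>C (f \<star> g)"
  by (rule dual_eqI; simp add: pairing_mult algebra_simps)+

lemma dual_one_left: "dual_one \<star> f = f"
  by (rule dual_eqI) (use counit_left_apply[OF clinear_pairing] in
    \<open>simp add: pairing_mult pairing_one scaleC_complex_def\<close>)

lemma dual_one_right: "f \<star> dual_one = f"
  by (rule dual_eqI) (use counit_right_apply[OF clinear_pairing] in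
    \<open>simp add: pairing_mult pairing_one scaleC_complex_def mult.commute\<close>)

lemma right_act_simps:
  "right_act A f (x + y) = right_act A f x + right_act A f y"
  "right_act A f (c *\<^sub>C x) = c *\<^sub>C right_act A f x"
  "right_act A (f + g) x = right_act A f x + right_act A g x"
  "right_act A (c *\<^sub>C f) x = c *\<^sub>C right_act A f x"
  "right_act A f \<one> = f"
  by (rule dual_eqI; simp add: pairing_right_act[OF algebra] alg_simps)+

lemma right_act_dual_one: "right_act A dual_one x = \<epsilon> x *\<^sub>C dual_one"
  by (rule dual_eqI) (simp add: pairing_right_act[OF algebra] pairing_one bialg_simps)

text \<open>Here \<open>\<kappa> f y\<close> stands for the pairing of \<open>f\<close> with k(y),
  and \<open>fusion\<close> is the equation for k paired with \<open>f\<close> and \<open>g\<close>.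
  The argument separates the variables of \<kappa> into a grouplike element and a scalar function
  \<phi>, then cancels both.\<close>

lemma trivial_if_fusion:
  fixes \<kappa> :: "'a dual \<Rightarrow> 'a \<Rightarrow> complex"
  assumes \<sigma>: "clinear \<sigma>" "surj \<sigma>" "\<And>y. \<epsilon> (\<sigma> y) = \<epsilon> y" "\<sigma> \<one> = \<one>"
    and \<kappa>: "cbilinear \<kappa>" "\<kappa> dual_one \<one> = 1"
    and fusion: "\<And>f g y z. \<kappa> f y * \<kappa> g z =
      tensor_lift (\<lambda>y\<^sub>1 y\<^sub>2. \<kappa> (f \<star> right_act A g (\<sigma> y\<^sub>2)) (z \<bullet> y\<^sub>1)) (\<Delta> y)"
  shows "y = \<epsilon> y *\<^sub>C \<one>"
proof -
  define \<gamma> where "\<gamma> f = \<kappa> f \<one>" for f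
  define \<phi> where "\<phi> y = \<kappa> dual_one y" for y
  note \<kappa>_simps = cbilinear_simps[OF \<kappa>(1)]
  note \<sigma>_simps = clinear_add[OF \<sigma>(1)] clinear_scaleC[OF \<sigma>(1)]
  have \<phi>_lin: "clinear \<phi>" by (auto intro!: clinearI simp: \<phi>_def \<kappa>_simps)
  have \<gamma>_lin: "clinear \<gamma>" by (auto intro!: clinearI simp: \<gamma>_def \<kappa>_simps)
  \<comment> \<open>Take the counit for \<open>g\<close>: the action becomes multiplication by the
    counit of \<open>\<sigma> y\<^sub>2\<close>, which is that of \<open>y\<^sub>2\<close>, and the
    Sweedler sum collapses.\<close>
  have *: "\<kappa> f (z \<bullet> y) = \<kappa> f y * \<phi> z" for f y z
  proof -
    have "clinear (\<lambda>y. \<kappa> f (z \<bullet> y))"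
      by (auto intro!: clinearI simp: \<kappa>_simps alg_simps)
    from counit_right_apply[OF this, of y] show ?thesis
      unfolding \<phi>_def fusion[of f y dual_one z]
      by (simp add: right_act_dual_one \<sigma> dual_alg_simps dual_one_right \<kappa>_simps scaleC_complex_def)
  qed
  \<comment> \<open>Setting the right factor to the unit separates the variables, so k has rank
    one.\<close>
  have \<kappa>_eq: "\<kappa> f z = \<gamma> f * \<phi> z" for f z
    using *[of f z \<one>] by (simp add: \<gamma>_def alg_simps)
  have \<phi>_mult: "\<phi> (z \<bullet> y) = \<phi> y * \<phi> z" for y z
    using *[of dual_one z y] by (simp add: \<phi>_def)
  have \<phi>_one: "\<phi> \<one> = 1" and \<gamma>_one: "\<gamma> dual_one = 1" by (simp_all add: \<phi>_def \<gamma>_def \<kappa>)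
  \<comment> \<open>This is \<open>fusion\<close> at y = z = 1, where the coproduct is a pure tensor
    and \<sigma> fixes the unit.\<close>
  have \<gamma>_mult: "\<gamma> (f \<star> g) = \<gamma> f * \<gamma> g" for f g
  proof -
    have "cbilinear (\<lambda>y\<^sub>1 y\<^sub>2. \<kappa> (f \<star> right_act A g (\<sigma> y\<^sub>2)) (\<one> \<bullet> y\<^sub>1))"
      by (rule cbilinearI) (simp_all add: \<kappa>_simps \<sigma>_simps alg_simps right_act_simps dual_alg_simps)
    then show ?thesis
      using fusion[of f \<one> g \<one>]
      by (simp add: bialg_simps tensor_lift_tensor \<sigma> right_act_simps alg_simps \<gamma>_def)
  qed
  \<comment> \<open>By finite dimension the functional \<gamma> on the dual is evaluation at an
    element, namely \<open>G\<close>.\<close>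
  define G where "G = (\<Sum>b\<in>B. \<gamma> (dual_vector B b) *\<^sub>C b)"
  have G: "pairing f G = \<gamma> f" for f
  proof -
    have "\<gamma> f = \<gamma> (\<Sum>b\<in>B. pairing f b *\<^sub>C dual_vector B b)"
      by (simp add: dual_basis_expansion[OF basis])
    then show ?thesis
      by (simp add: G_def clinear_sum[OF clinear_pairing] clinear_sum[OF \<gamma>_lin]
          clinear_scaleC[OF \<gamma>_lin] scaleC_complex_def mult.commute)
  qed
  have GS: "G \<bullet> S G = \<one>"
  proof -
    have bil: "cbilinear (\<lambda>x y. x \<bullet> S y)"
      by (rule cbilinearI) (simp_all add: alg_simps lin_simps)
    have bil': "cbilinear (\<lambda>x y. pairing f x * pairing g y)" for f g :: "'a dual"
      by (rule cbilinearI) (simp_all add: scaleC_distribs algebra_simps)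
    \<comment> \<open>Multiplicativity of \<gamma> says that \<Delta> \<open>G\<close> and
      \<open>G \<otimes> G\<close> have the same coefficients. The antipode axiom at
      \<open>G\<close> then exhibits \<open>S G\<close> as a right inverse.\<close>
    have "tensor_lift (\<lambda>x y. x \<bullet> S y) (\<Delta> G) = tensor_lift (\<lambda>x y. x \<bullet> S y) (G \<otimes> G)"
      unfolding tensor_lift_expansion[OF basis bil, of "\<Delta> G"] tensor_lift_expansion[OF basis bil, of "G \<otimes> G"]
      by (simp add: tensor_lift_tensor bil' pairing_mult[symmetric] G \<gamma>_mult)
    then show ?thesis
      using pairing_one[of G] by (simp add: antipode_right tensor_lift_tensor bil G \<gamma>_one scaleC_one)
  qed
  \<comment> \<open>Now the counit is put in the first slot of \<open>fusion\<close> and z = 1,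
    while the second functional remains arbitrary and tests equality of elements.\<close>
  have "tensor_lift (\<lambda>y\<^sub>1 y\<^sub>2. \<phi> y\<^sub>1 *\<^sub>C (\<sigma> y\<^sub>2 \<bullet> G)) (\<Delta> y) = \<phi> y *\<^sub>C G" for y
  proof (rule eq_by_pairing[OF basis])
    fix f
    show "pairing f (tensor_lift (\<lambda>y\<^sub>1 y\<^sub>2. \<phi> y\<^sub>1 *\<^sub>C (\<sigma> y\<^sub>2 \<bullet> G)) (\<Delta> y)) = pairing f (\<phi> y *\<^sub>C G)"
      using fusion[of dual_one y f \<one>]
      by (simp add: clinear_tensor_lift_apply[OF clinear_pairing] pairing_right_act[OF algebra, symmetric]
          G \<kappa>_eq \<gamma>_one \<phi>_one dual_one_left alg_simps mult.commute)
  qed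
  note cancel = this
  have \<phi>\<sigma>: "tensor_lift (\<lambda>y\<^sub>1 y\<^sub>2. \<phi> y\<^sub>1 *\<^sub>C \<sigma> y\<^sub>2) (\<Delta> y) = \<phi> y *\<^sub>C \<one>" for y
  proof -
    have "clinear (\<lambda>x. x \<bullet> S G)" by (auto intro!: clinearI simp: alg_simps)
    from clinear_tensor_lift_apply[OF this, of "\<lambda>y\<^sub>1 y\<^sub>2. \<phi> y\<^sub>1 *\<^sub>C (\<sigma> y\<^sub>2 \<bullet> G)" "\<Delta> y"]
    show ?thesis by (simp add: cancel alg_simps algebra_assoc[OF algebra] GS)
  qed
  \<comment> \<open>The composite of \<phi> with \<open>S\<close> is a left convolution inverse of
    \<phi>: \<phi> reverses products, but its values are commuting scalars.\<close>
  have S\<phi>: "tensor_lift (\<lambda>y\<^sub>1 y\<^sub>2. \<phi> (S y\<^sub>1) * \<phi> y\<^sub>2) (\<Delta> y) = \<epsilon> y" for y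
    using clinear_tensor_lift_apply[OF \<phi>_lin, of "\<lambda>x\<^sub>1 x\<^sub>2. S x\<^sub>1 \<bullet> x\<^sub>2" "\<Delta> y"]
    by (simp add: antipode_left clinear_scaleC[OF \<phi>_lin] \<phi>_mult \<phi>_one scaleC_complex_def mult.commute)
  \<comment> \<open>Convolve \<open>\<phi>\<sigma>\<close> on the left with this inverse;
    coassociativity regroups the three factors.\<close>
  have trivial: "\<sigma> y = \<epsilon> y *\<^sub>C \<one>" for y
  proof -
    note simps = clinear_add[OF \<phi>_lin] clinear_scaleC[OF \<phi>_lin] \<sigma>_simps lin_simps scaleC_distribs
    have bil: "cbilinear (\<lambda>y\<^sub>2 y\<^sub>3. (\<phi> (S y\<^sub>1) * \<phi> y\<^sub>2) *\<^sub>C \<sigma> y\<^sub>3)" for y\<^sub>1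
      by (rule cbilinearI) (simp_all add: simps algebra_simps)
    have bil1: "cbilinear (\<lambda>y\<^sub>2 y\<^sub>3. \<phi> y\<^sub>2 *\<^sub>C \<sigma> y\<^sub>3)"
      by (rule cbilinearI) (simp_all add: simps algebra_simps)
    have bil2: "cbilinear (\<lambda>y\<^sub>1 s. tensor_lift (\<lambda>y\<^sub>2 y\<^sub>3. (\<phi> (S y\<^sub>1) * \<phi> y\<^sub>2) *\<^sub>C \<sigma> y\<^sub>3) s)"
      unfolding scaleC_scaleC[symmetric] tensor_lift_fun_simps
      by (rule cbilinearI) (simp_all add: simps tensor_lift_simps bil1 mult_ac)
    have "\<sigma> y = tensor_lift (\<lambda>s y\<^sub>3. \<epsilon> s *\<^sub>C \<sigma> y\<^sub>3) (\<Delta> y)"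
      by (simp add: counit_left_apply \<sigma>)
    also have "\<dots> = tensor_lift (\<lambda>s y\<^sub>3. tensor_lift (\<lambda>y\<^sub>1 y\<^sub>2. (\<phi> (S y\<^sub>1) * \<phi> y\<^sub>2) *\<^sub>C \<sigma> y\<^sub>3) (\<Delta> s)) (\<Delta> y)"
      by (simp only: tensor_lift_fun_scaleC_const S\<phi>)
    also have "\<dots> = tensor_lift (\<lambda>y\<^sub>1 s. tensor_lift (\<lambda>y\<^sub>2 y\<^sub>3. (\<phi> (S y\<^sub>1) * \<phi> y\<^sub>2) *\<^sub>C \<sigma> y\<^sub>3) (\<Delta> s)) (\<Delta> y)"
      by (rule coassoc[OF bil bil2])
    also have "\<dots> = tensor_lift (\<lambda>y\<^sub>1 s. \<phi> (S y\<^sub>1) *\<^sub>C \<phi> s *\<^sub>C \<one>) (\<Delta> y)"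
      by (simp only: scaleC_scaleC[symmetric] tensor_lift_fun_simps \<phi>\<sigma>)
    also have "\<dots> = \<epsilon> y *\<^sub>C \<one>"
      by (simp only: scaleC_scaleC tensor_lift_fun_scaleC_const S\<phi>)
    finally show ?thesis .
  qed
  obtain x where x: "y = \<sigma> x" using \<sigma>(2) by (rule surjE)
  have "y = \<epsilon> x *\<^sub>C \<one>" using x trivial by simp
  moreover have "\<epsilon> y = \<epsilon> x" using x \<sigma>(3) by simp
  ultimately show ?thesis by simp
qed

end


section \<open>The quantum double\<close>

locale finite_double = finite_hopf A S B
  for A :: "'a::complex_vector bialg" and S B +
  fixes D :: "'a double bialg"
  assumes double: "quantum_double A D"
begin

section \<open>Structure maps of the double on products of its two factors\<close>

lemma H_minus_simps:
  "alg_mult (H_minus A) = alg_mult (dual_alg A)" "alg_one (H_minus A) = dual_one"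
  "comult (H_minus A) \<xi> = tensor_flip (dual_comult A \<xi>)" "counit (H_minus A) \<xi> = pairing \<xi> \<one>"
  by (simp_all add: H_minus_def co_opposite_def dual_bialg_def)

text \<open>The opposite coproduct reverses the factors, which is where the order
  \<open>z \<bullet> y\<close> in the fusion equation comes from.\<close>

lemma comult_minus:
  "tensor_lift (\<lambda>\<xi>\<^sub>1 \<xi>\<^sub>2. pairing \<xi>\<^sub>1 y * pairing \<xi>\<^sub>2 z) (comult (H_minus A) \<xi>) = pairing \<xi> (z \<bullet> y)"
proof -
  have "cbilinear (\<lambda>\<xi>\<^sub>1 \<xi>\<^sub>2. pairing \<xi>\<^sub>1 y * pairing \<xi>\<^sub>2 z)"
    by (rule cbilinearI) (simp_all add: scaleC_distribs algebra_simps)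
  then show ?thesis
    using dual_comult[OF basis algebra, of z y \<xi>]
    by (simp add: H_minus_simps tensor_lift_flip mult.commute)
qed

lemma bialgebra_D: "bialgebra D" and hom_plus: "bialgebra_hom A D (incl_plus A)"
  and hom_minus: "bialgebra_hom (H_minus A) D (incl_minus A)"
  using double by (simp_all add: quantum_double_def)

lemma algebra_D: "algebra D" and clinear_comult_D: "clinear (comult D)"
  and clinear_counit_D: "clinear (counit D)"
  using bialgebra_D by (simp_all add: bialgebra_def coalgebra_def)

lemmas D_simps = algebra_bilinear[OF algebra_D] algebra_one[OF algebra_D]

lemma plus_mult: "alg_mult D (incl_plus A h) (x \<otimes> \<xi>) = (h \<bullet> x) \<otimes> \<xi>"
  and minus_mult: "alg_mult D (x \<otimes> \<xi>) (incl_minus A \<eta>) = x \<otimes> (\<xi> \<star> \<eta>)"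
  using double by (simp_all add: quantum_double_def H_minus_simps)

lemma plus_minus: "alg_mult D (incl_plus A x) (incl_minus A \<xi>) = x \<otimes> \<xi>"
  unfolding incl_minus_def by (simp add: plus_mult alg_simps)

lemma incl_plus_simps:
  "incl_plus A (x + y) = incl_plus A x + incl_plus A y"
  "incl_plus A (c *\<^sub>C x) = c *\<^sub>C incl_plus A x"
  "alg_mult D (incl_plus A x) (incl_plus A y) = incl_plus A (x \<bullet> y)"
  "incl_plus A \<one> = alg_one D" "counit D (incl_plus A x) = \<epsilon> x"
  "comult D (incl_plus A x) = tensor_map (incl_plus A) (incl_plus A) (\<Delta> x)"
  using hom_plus by (simp_all add: bialgebra_hom_def coalgebra_hom_def clinear_iff)

lemma incl_minus_simps:
  "incl_minus A (\<xi> + \<eta>) = incl_minus A \<xi> + incl_minus A \<eta>"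
  "incl_minus A (c *\<^sub>C \<xi>) = c *\<^sub>C incl_minus A \<xi>"
  "alg_mult D (incl_minus A \<xi>) (incl_minus A \<eta>) = incl_minus A (\<xi> \<star> \<eta>)"
  "incl_minus A dual_one = alg_one D" "counit D (incl_minus A \<xi>) = pairing \<xi> \<one>"
  "comult D (incl_minus A \<xi>) = tensor_map (incl_minus A) (incl_minus A) (comult (H_minus A) \<xi>)"
  using hom_minus by (simp_all add: bialgebra_hom_def coalgebra_hom_def H_minus_simps clinear_iff)

lemma counit_D: "counit D (x \<otimes> \<xi>) = \<epsilon> x * pairing \<xi> \<one>"
  using bialgebra_D
  by (simp add: plus_minus[symmetric] bialgebra_def incl_plus_simps incl_minus_simps)

text \<open>Write the argument as a product of its two factors: the coproduct of \<open>D\<close> is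
  multiplicative, both inclusions respect coproducts, and the resulting products have the order in
  which they are again pure tensors.\<close>

lemma tensor_lift_comult_D:
  assumes h: "cbilinear h"
  shows "tensor_lift h (comult D (x \<otimes> \<xi>)) = tensor_lift (\<lambda>x\<^sub>1 x\<^sub>2.
    tensor_lift (\<lambda>\<xi>\<^sub>1 \<xi>\<^sub>2. h (x\<^sub>1 \<otimes> \<xi>\<^sub>1) (x\<^sub>2 \<otimes> \<xi>\<^sub>2)) (comult (H_minus A) \<xi>)) (\<Delta> x)"
proof -
  have "comult D (x \<otimes> \<xi>) = alg_mult (tensor_alg D D) (comult D (incl_plus A x)) (comult D (incl_minus A \<xi>))"
    using bialgebra_D by (simp add: plus_minus[symmetric] bialgebra_def)
  moreover have bil: "cbilinear (\<lambda>u v. h (alg_mult D s u) (alg_mult D t v))" for s t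
    by (rule cbilinearI) (simp_all add: D_simps cbilinear_simps[OF h])
  moreover have bil2: "cbilinear (\<lambda>s t. tensor_lift (\<lambda>u v. h (alg_mult D s u) (alg_mult D t v)) w)" for w
    by (rule cbilinearI) (simp_all add: D_simps cbilinear_simps[OF h])
  ultimately have "tensor_lift h (comult D (x \<otimes> \<xi>)) = tensor_lift (\<lambda>x\<^sub>1 x\<^sub>2.
      tensor_lift (\<lambda>u v. h (alg_mult D (incl_plus A x\<^sub>1) u) (alg_mult D (incl_plus A x\<^sub>2) v))
        (comult D (incl_minus A \<xi>))) (\<Delta> x)"
    by (simp only: tensor_lift_mult[OF h] incl_plus_simps(6) tensor_lift_map[OF bil2])
  then show ?thesis
    by (simp only: incl_minus_simps(6) tensor_lift_map[OF bil] plus_minus)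
qed

text \<open>This underlies the fact that elements of H_- \<otimes> H_+ multiply as linear maps under
  convolution. The coefficients of \<Delta> \<open>d\<close> are values at \<open>d\<close> of
  products of dual basis vectors, and summing over \<open>d\<close> restores these products.\<close>

lemma convolution_expansion:
  assumes "clinear f" "clinear g"
  shows "(\<Sum>b\<in>B. \<Sum>c\<in>B. incl_minus A (dual_vector B b \<star> dual_vector B c) \<otimes> incl_plus A (f b \<bullet> g c)) =
    (\<Sum>d\<in>B. incl_minus A (dual_vector B d) \<otimes> incl_plus A (tensor_lift (\<lambda>x y. f x \<bullet> g y) (\<Delta> d)))"
proof -
  let ?v = "dual_vector B"
  have bil: "cbilinear (\<lambda>x y. f x \<bullet> g y)"
    by (rule cbilinearI) (simp_all add: alg_simps clinear_add[OF assms(1)] clinear_scaleC[OF assms(1)]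
        clinear_add[OF assms(2)] clinear_scaleC[OF assms(2)])
  have plus: "clinear (incl_plus A)" and minus: "clinear (incl_minus A)"
    by (auto intro!: clinearI simp: incl_plus_simps incl_minus_simps)
  have "(\<Sum>d\<in>B. incl_minus A (?v d) \<otimes> incl_plus A (tensor_lift (\<lambda>x y. f x \<bullet> g y) (\<Delta> d))) =
      (\<Sum>d\<in>B. \<Sum>b\<in>B. \<Sum>c\<in>B. incl_minus A (pairing (?v b \<star> ?v c) d *\<^sub>C ?v d) \<otimes> incl_plus A (f b \<bullet> g c))"
    unfolding tensor_lift_expansion[OF basis bil] pairing_mult[symmetric]
    by (simp add: clinear_sum[OF plus] incl_plus_simps incl_minus_simps cbilinear_sum[OF cbilinear_tensor])
  also have "\<dots> = (\<Sum>b\<in>B. \<Sum>c\<in>B. \<Sum>d\<in>B. incl_minus A (pairing (?v b \<star> ?v c) d *\<^sub>C ?v d) \<otimes> incl_plus A (f b \<bullet> g c))"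
    by (subst sum.swap, rule sum.cong[OF refl], rule sum.swap)
  also have "\<dots> = (\<Sum>b\<in>B. \<Sum>c\<in>B. incl_minus A (?v b \<star> ?v c) \<otimes> incl_plus A (f b \<bullet> g c))"
    by (simp only: cbilinear_sum(1)[OF cbilinear_tensor, symmetric] clinear_sum[OF minus, symmetric]
        dual_basis_expansion[OF basis])
  finally show ?thesis by simp
qed

section \<open>The canonical element and the universal R-matrix\<close>

definition canonical :: "('a double, 'a double) tensor" where
  "canonical = (\<Sum>b\<in>B. incl_minus A (dual_vector B b) \<otimes> incl_plus A b)"

text \<open>The R-matrix is itself an inverse, and the twisted product inverts it again. For both
  inversions to be meaningful the canonical element must be invertible, and the antipode supplies
  the inverse.\<close>

lemma alg_inverse_universal_R: "alg_inverse (tensor_alg D D) (universal_R A D B) = canonical"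
proof -
  let ?T = "tensor_alg D D"
  note T = algebra_tensor_alg[OF algebra_D algebra_D]
  have Tbil: "cbilinear (alg_mult ?T)" using T by (simp add: algebra_def)
  \<comment> \<open>\<open>Q\<close> turns convolution into multiplication: the identity gives
    \<open>canonical\<close>, \<open>S\<close> gives its inverse, and the convolution unit gives the
    unit.\<close>
  define Q where "Q f = (\<Sum>b\<in>B. incl_minus A (dual_vector B b) \<otimes> incl_plus A (f b))" for f
  have "alg_mult ?T (s \<otimes> t) (s' \<otimes> t') = alg_mult D s s' \<otimes> alg_mult D t t'" for s t s' t'
  proof -
    have "cbilinear (\<lambda>x' y'. alg_mult D x x' \<otimes> alg_mult D y y')" for x y
      by (rule cbilinearI) (simp_all add: D_simps)
    moreover have "cbilinear (\<lambda>x y. tensor_lift (\<lambda>x' y'. alg_mult D x x' \<otimes> alg_mult D y y') t)" for t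
      by (rule cbilinearI) (simp_all add: D_simps)
    ultimately show ?thesis by (simp add: tensor_alg_def tensor_lift_tensor)
  qed
  then have QQ: "alg_mult ?T (Q f) (Q g) = Q (\<lambda>d. tensor_lift (\<lambda>x y. f x \<bullet> g y) (\<Delta> d))"
    if "clinear f" "clinear g" for f g
    unfolding Q_def convolution_expansion[OF that, symmetric]
    by (simp only: cbilinear_sum(1)[OF Tbil])
      (simp add: cbilinear_sum[OF Tbil] incl_plus_simps incl_minus_simps)
  have "clinear (\<lambda>x::'a. x)" by (simp add: clinear_iff)
  moreover have "Q (\<lambda>d. \<epsilon> d *\<^sub>C \<one>) = alg_one ?T"
  proof -
    have minus: "clinear (incl_minus A)" by (auto intro!: clinearI simp: incl_minus_simps)
    have "Q (\<lambda>d. \<epsilon> d *\<^sub>C \<one>) = incl_minus A (\<Sum>d\<in>B. pairing dual_one d *\<^sub>C dual_vector B d) \<otimes> alg_one D"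
      by (simp add: Q_def clinear_sum[OF minus] cbilinear_sum[OF cbilinear_tensor] pairing_one
          incl_plus_simps incl_minus_simps)
    then show ?thesis
      by (simp only: dual_basis_expansion[OF basis] incl_minus_simps) (simp add: tensor_alg_def)
  qed
  ultimately have inv: "alg_mult ?T (Q (\<lambda>x. x)) (Q S) = alg_one ?T" "alg_mult ?T (Q S) (Q (\<lambda>x. x)) = alg_one ?T"
    by (simp_all add: QQ clinear_antipode antipode_left antipode_right)
  have "universal_R A D B = Q S"
    unfolding universal_R_def using alg_inverse_eqI[OF T inv] by (simp add: Q_def)
  then show ?thesis
    using alg_inverse_eqI[OF T inv(2,1)] by (simp add: Q_def canonical_def)
qed

text \<open>The element f \<otimes> y of the dual of the double, with \<open>y\<close> acting on the
  second factor by evaluation. The values of a character on these functionals are the matrix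
  coefficients of k.\<close>

definition elem :: "'a dual \<Rightarrow> 'a \<Rightarrow> 'a double dual" where
  "elem f y = Dual (tensor_lift (\<lambda>x \<xi>. pairing f x * pairing \<xi> y))"

lemma cbilinear_elem_fun: "cbilinear (\<lambda>x \<xi>. pairing f x * pairing \<xi> y)"
  by (rule cbilinearI) (simp_all add: scaleC_distribs algebra_simps)

lemma pairing_elem: "pairing (elem f y) t = tensor_lift (\<lambda>x \<xi>. pairing f x * pairing \<xi> y) t"
  by (simp add: elem_def clinear_tensor_lift cbilinear_elem_fun)

lemma pairing_elem_tensor: "pairing (elem f y) (x \<otimes> \<xi>) = pairing f x * pairing \<xi> y"
  by (simp add: pairing_elem tensor_lift_tensor cbilinear_elem_fun)

lemma dual_double_eqI:
  fixes a b :: "'a double dual"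
  assumes "\<And>x \<xi>. pairing a (x \<otimes> \<xi>) = pairing b (x \<otimes> \<xi>)"
  shows "a = b"
  by (rule dual_eqI, rule tensor_ext) (use assms in \<open>simp_all add: clinear_pairing\<close>)

lemma elem_simps:
  "elem (f + g) y = elem f y + elem g y" "elem (c *\<^sub>C f) y = c *\<^sub>C elem f y"
  "elem f (y + z) = elem f y + elem f z" "elem f (c *\<^sub>C y) = c *\<^sub>C elem f y"
  by (rule dual_double_eqI; simp add: pairing_elem_tensor algebra_simps)+

lemma elem_one: "elem dual_one \<one> = alg_one (dual_alg D)"
  by (rule dual_double_eqI)
    (simp add: pairing_elem_tensor pairing_one pairing_dual_one clinear_counit_D counit_D)

text \<open>Since \<tau> keeps the first leg of the canonical element in H_-, that leg multiplies
  from the right and the second leg, in H_+, from the left; both products are given by the bimodule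
  structure. The sum over the basis is the transpose of \<theta> at
  \<open>y\<^sub>2\<close>.\<close>

lemma RE_dual_mult_elem:
  assumes \<tau>: "clinear \<tau>" "\<And>\<xi>. \<tau> (incl_minus A \<xi>) = incl_minus A (\<theta> \<xi>)"
  shows "alg_mult (RE_dual D \<tau> (universal_R A D B)) (elem f y) (elem g z) =
    tensor_lift (\<lambda>y\<^sub>1 y\<^sub>2. elem (f \<star> right_act A g (\<Sum>b\<in>B. pairing (\<theta> (dual_vector B b)) y\<^sub>2 *\<^sub>C b)) (z \<bullet> y\<^sub>1))
      (\<Delta> y)" (is "?lhs = ?rhs")
proof (rule dual_double_eqI)
  fix x \<xi>
  let ?a = "elem f y" and ?b = "elem g z"
  let ?\<sigma> = "\<lambda>y. \<Sum>b\<in>B. pairing (\<theta> (dual_vector B b)) y *\<^sub>C b"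
  let ?h = "\<lambda>r\<^sub>1 r\<^sub>2 h\<^sub>1 h\<^sub>2. pairing ?a (alg_mult D h\<^sub>1 (\<tau> r\<^sub>1)) * pairing ?b (alg_mult D r\<^sub>2 h\<^sub>2)"
  let ?F = "\<lambda>r\<^sub>1 r\<^sub>2. tensor_lift (?h r\<^sub>1 r\<^sub>2) (comult D (x \<otimes> \<xi>))"
  have h: "cbilinear (?h r\<^sub>1 r\<^sub>2)" for r\<^sub>1 r\<^sub>2
    by (rule cbilinearI) (simp_all add: D_simps scaleC_distribs algebra_simps)
  have F: "cbilinear ?F"
    by (rule cbilinearI) (simp_all add: D_simps clinear_add[OF \<tau>(1)] clinear_scaleC[OF \<tau>(1)]
        scaleC_distribs distrib_left distrib_right mult_ac)
  have "pairing ?lhs (x \<otimes> \<xi>) = tensor_lift ?F canonical"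
    by (simp add: RE_dual_def alg_inverse_universal_R clinear_tensor_lift_apply[OF clinear_pairing_left]
        pairing_dual_mult clinear_comult_D pairing_left_act pairing_right_act algebra_D)
  also have "\<dots> = (\<Sum>b\<in>B. ?F (incl_minus A (dual_vector B b)) (incl_plus A b))"
    by (simp add: canonical_def clinear_sum[OF clinear_tensor_lift[OF F]] tensor_lift_tensor F)
  also have "\<dots> = (\<Sum>b\<in>B. tensor_lift (\<lambda>x\<^sub>1 x\<^sub>2. tensor_lift (\<lambda>\<xi>\<^sub>1 \<xi>\<^sub>2.
      (pairing f x\<^sub>1 * tensor_lift (\<lambda>y\<^sub>1 y\<^sub>2. pairing \<xi>\<^sub>1 y\<^sub>1 * pairing (\<theta> (dual_vector B b)) y\<^sub>2) (\<Delta> y)) *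
      (pairing g (b \<bullet> x\<^sub>2) * pairing \<xi>\<^sub>2 z)) (comult (H_minus A) \<xi>)) (\<Delta> x))"
    unfolding tensor_lift_comult_D[OF h]
    by (simp only: \<tau>(2) minus_mult plus_mult pairing_elem_tensor pairing_mult)
  also have "\<dots> = (\<Sum>b\<in>B. tensor_lift (\<lambda>x\<^sub>1 x\<^sub>2. tensor_lift (\<lambda>\<xi>\<^sub>1 \<xi>\<^sub>2. tensor_lift (\<lambda>y\<^sub>1 y\<^sub>2.
      (pairing f x\<^sub>1 * (pairing (\<theta> (dual_vector B b)) y\<^sub>2 * pairing g (b \<bullet> x\<^sub>2))) * (pairing \<xi>\<^sub>1 y\<^sub>1 * pairing \<xi>\<^sub>2 z))
      (\<Delta> y)) (comult (H_minus A) \<xi>)) (\<Delta> x))"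
    by (simp only: tensor_lift_fun_simps(3,4)[symmetric] mult_ac)
  \<comment> \<open>Exchanging the two inner sums lets \<open>comult_minus\<close> contract the
    components of \<xi>.\<close>
  also have "\<dots> = (\<Sum>b\<in>B. tensor_lift (\<lambda>x\<^sub>1 x\<^sub>2. tensor_lift (\<lambda>y\<^sub>1 y\<^sub>2.
      (pairing f x\<^sub>1 * (pairing (\<theta> (dual_vector B b)) y\<^sub>2 * pairing g (b \<bullet> x\<^sub>2))) * pairing \<xi> (z \<bullet> y\<^sub>1))
      (\<Delta> y)) (\<Delta> x))"
    by (subst tensor_lift_swap) (simp only: tensor_lift_fun_simps(3) comult_minus)
  also have "\<dots> = tensor_lift (\<lambda>y\<^sub>1 y\<^sub>2. tensor_lift (\<lambda>x\<^sub>1 x\<^sub>2.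
      (pairing f x\<^sub>1 * (\<Sum>b\<in>B. pairing (\<theta> (dual_vector B b)) y\<^sub>2 * pairing g (b \<bullet> x\<^sub>2))) * pairing \<xi> (z \<bullet> y\<^sub>1))
      (\<Delta> x)) (\<Delta> y)"
    by (subst tensor_lift_swap) (simp only: tensor_lift_fun_sum[symmetric] sum_distrib_left sum_distrib_right)
  \<comment> \<open>By linearity the sum over the basis moves into the argument of the
    action.\<close>
  also have "\<dots> = tensor_lift (\<lambda>y\<^sub>1 y\<^sub>2. tensor_lift (\<lambda>x\<^sub>1 x\<^sub>2.
      (pairing f x\<^sub>1 * pairing (right_act A g (?\<sigma> y\<^sub>2)) x\<^sub>2) * pairing \<xi> (z \<bullet> y\<^sub>1)) (\<Delta> x)) (\<Delta> y)"
  proof -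
    have "(\<Sum>b\<in>B. pairing (\<theta> (dual_vector B b)) y\<^sub>2 * pairing g (b \<bullet> x\<^sub>2)) = pairing (right_act A g (?\<sigma> y\<^sub>2)) x\<^sub>2" for y\<^sub>2 x\<^sub>2
    proof -
      have "clinear (\<lambda>u. pairing g (u \<bullet> x\<^sub>2))"
        by (auto intro!: clinearI simp: alg_simps scaleC_complex_def)
      then show ?thesis
        by (simp add: pairing_right_act[OF algebra] clinear_sum[where f = "\<lambda>u. pairing g (u \<bullet> x\<^sub>2)"] alg_simps)
    qed
    then show ?thesis by simp
  qed
  also have "\<dots> = pairing ?rhs (x \<otimes> \<xi>)"
    by (simp only: clinear_tensor_lift_apply[OF clinear_pairing_left] pairing_elem_tensor
        tensor_lift_fun_simps(4) pairing_mult)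
  finally show "pairing ?lhs (x \<otimes> \<xi>) = pairing ?rhs (x \<otimes> \<xi>)" .
qed

lemma dim_double_if_trivial:
  assumes "\<And>y. y = \<epsilon> y *\<^sub>C \<one>"
  shows "complex_vector.dim (UNIV :: 'a double set) = 1"
proof -
  let ?u = "\<one> \<otimes> dual_one"
  have \<xi>: "\<xi> = pairing \<xi> \<one> *\<^sub>C dual_one" for \<xi>
  proof (rule dual_eqI)
    fix y
    have "pairing \<xi> y = pairing \<xi> (\<epsilon> y *\<^sub>C \<one>)" using assms[of y] by simp
    then show "pairing \<xi> y = pairing (pairing \<xi> \<one> *\<^sub>C dual_one) y" by (simp add: pairing_one)
  qed
  have "x \<otimes> \<xi> = (\<epsilon> x * pairing \<xi> \<one>) *\<^sub>C ?u" for x \<xi>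
  proof -
    have "x \<otimes> \<xi> = (\<epsilon> x *\<^sub>C \<one>) \<otimes> (pairing \<xi> \<one> *\<^sub>C dual_one)" using assms[of x] \<xi>[of \<xi>] by simp
    then show ?thesis by (simp add: scaleC_scaleC mult.commute)
  qed
  then have "(\<otimes>) = (\<lambda>x \<xi>. (\<epsilon> x * pairing \<xi> \<one>) *\<^sub>C ?u)" by (intro ext)
  then have "t = tensor_lift (\<lambda>x \<xi>. \<epsilon> x * pairing \<xi> \<one>) t *\<^sub>C ?u" for t
    using tensor_lift_id[of t] by (metis tensor_lift_fun_scaleC_const)
  then have "complex_vector.span {?u} = UNIV"
    by (metis UNIV_eq_I complex_vector.span_base complex_vector.span_scale insertI1)
  \<comment> \<open>The counit of \<open>D\<close> takes the value 1 on this tensor.\<close>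
  moreover have "?u \<noteq> 0"
    using counit_D[of \<one> dual_one] by (auto simp: bialg_simps pairing_one clinear_zero[OF clinear_counit_D])
  then have "complex_vector.independent {?u}"
    by simp
  ultimately have "complex_vector.dim (UNIV :: 'a double set) = card {?u}"
    by (intro complex_vector.dim_unique) auto
  then show ?thesis by simp
qed

end

section \<open>From a character to the fusion equation\<close>

theorem proposition21:
  fixes Hp :: "'a::complex_vector bialg"
    and S :: "'a \<Rightarrow> 'a"
    and B :: "'a set"
    and D :: "'a double bialg"
    and \<tau> :: "'a double \<Rightarrow> 'a double"
  assumes "bialgebra Hp" and "antipode Hp S" and "bij S"
    and "finite_basis B"
    and "quantum_double Hp D"
    and "involution D \<tau>"
    and "\<tau> ` range (incl_plus Hp) \<subseteq> range (incl_plus Hp)"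
    and "\<tau> ` range (incl_minus Hp) \<subseteq> range (incl_minus Hp)"
    and "complex_vector.dim (UNIV :: 'a double set) \<noteq> 1"
  shows "\<not> (\<exists>\<chi>. character (RE_dual D \<tau> (universal_R Hp D B)) \<chi>)"
proof
  assume "\<exists>\<chi>. character (RE_dual D \<tau> (universal_R Hp D B)) \<chi>"
  then obtain \<chi> where \<chi>: "character (RE_dual D \<tau> (universal_R Hp D B)) \<chi>" ..
  interpret finite_double Hp S B D
    using assms by unfold_locales
  let ?u = "alg_one Hp" and ?e = "alg_one (dual_alg Hp)"
  have \<tau>: "clinear \<tau>" "\<tau> (\<tau> h) = h" "\<tau> (alg_one D) = alg_one D" "counit D (\<tau> h) = counit D h" for h
    using assms(6) by (auto simp: involution_def coalgebra_hom_def)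
  \<comment> \<open>\<open>P\<close> applies the counit to the first factor and so inverts
    \<open>incl_minus\<close> on its range; it serves to express the restriction of \<tau> to H_- as
    a map \<theta> of the dual.\<close>
  define P where "P = tensor_lift (\<lambda>x \<xi> :: 'a dual. counit Hp x *\<^sub>C \<xi>)"
  have P_bil: "cbilinear (\<lambda>x \<xi> :: 'a dual. counit Hp x *\<^sub>C \<xi>)"
    by (rule cbilinearI) (simp_all add: lin_simps scaleC_distribs mult.commute)
  have P: "P (incl_minus Hp \<xi>) = \<xi>" for \<xi>
    by (simp add: P_def incl_minus_def tensor_lift_tensor P_bil bialg_simps scaleC_one)
  define \<theta> where "\<theta> \<xi> = P (\<tau> (incl_minus Hp \<xi>))" for \<xi>
  have \<tau>\<theta>: "\<tau> (incl_minus Hp \<xi>) = incl_minus Hp (\<theta> \<xi>)" for \<xi>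
  proof -
    obtain \<eta> where "\<tau> (incl_minus Hp \<xi>) = incl_minus Hp \<eta>" using assms(8) by blast
    then show ?thesis by (simp add: \<theta>_def P)
  qed
  have \<theta>_lin: "clinear \<theta>"
    unfolding \<theta>_def P_def by (rule clinearI) (simp_all add: incl_minus_simps clinear_add[OF \<tau>(1)]
        clinear_scaleC[OF \<tau>(1)] tensor_lift_simps P_bil)
  have \<theta>\<theta>: "\<theta> (\<theta> \<xi>) = \<xi>" for \<xi>
    by (metis P \<tau>\<theta> \<tau>(2))
  have \<theta>_one: "\<theta> ?e = ?e"
    by (metis P \<tau>\<theta> \<tau>(3) incl_minus_simps(4))
  have \<theta>_counit: "pairing (\<theta> \<xi>) ?u = pairing \<xi> ?u" for \<xi>
    by (metis \<tau>\<theta> \<tau>(4) incl_minus_simps(5))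
  \<comment> \<open>The transpose of \<theta>, written in the basis. It inherits being an
    involution, hence surjectivity; it preserves the counit because \<theta> fixes the unit of the
    dual, and fixes the unit because \<theta> preserves evaluation there.\<close>
  define \<sigma> where "\<sigma> y = (\<Sum>b\<in>B. pairing (\<theta> (dual_vector B b)) y *\<^sub>C b)" for y
  have \<sigma>: "pairing f (\<sigma> y) = pairing (\<theta> f) y" for f y
  proof -
    have "\<theta> f = (\<Sum>b\<in>B. pairing f b *\<^sub>C \<theta> (dual_vector B b))"
      using clinear_sum[OF \<theta>_lin, of "\<lambda>b. pairing f b *\<^sub>C dual_vector B b" B]
      by (simp add: dual_basis_expansion[OF basis] clinear_scaleC[OF \<theta>_lin])
    then show ?thesis
      by (simp add: \<sigma>_def clinear_sum[OF clinear_pairing] clinear_sum[OF clinear_pairing_left] mult.commute)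
  qed
  have "\<sigma> (\<sigma> y) = y" for y
    by (rule eq_by_pairing[OF basis]) (simp add: \<sigma> \<theta>\<theta>)
  then have "surj \<sigma>" by (metis surjI)
  moreover have "clinear \<sigma>"
    by (rule clinearI; rule eq_by_pairing[OF basis]) (simp_all add: \<sigma>)
  moreover have "counit Hp (\<sigma> y) = counit Hp y" for y
    using \<sigma>[of ?e y] by (simp add: pairing_one \<theta>_one)
  moreover have "\<sigma> ?u = ?u"
    by (rule eq_by_pairing[OF basis]) (simp add: \<sigma> \<theta>_counit)
  moreover define \<kappa> where "\<kappa> f y = \<chi> (elem f y)" for f y
  have \<chi>_lin: "clinear \<chi>" using \<chi> by (simp add: character_def)
  have "cbilinear \<kappa>"
    unfolding \<kappa>_def by (rule cbilinearI) (simp_all add: elem_simps clinear_add[OF \<chi>_lin] clinear_scaleC[OF \<chi>_lin])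
  moreover have "\<kappa> ?e ?u = 1"
    using \<chi> by (simp add: \<kappa>_def elem_one character_def RE_dual_def)
  moreover have "\<kappa> f y * \<kappa> g z = tensor_lift
      (\<lambda>y\<^sub>1 y\<^sub>2. \<kappa> (alg_mult (dual_alg Hp) f (right_act Hp g (\<sigma> y\<^sub>2))) (alg_mult Hp z y\<^sub>1)) (comult Hp y)" for f g y z
  proof -
    \<comment> \<open>The fusion equation is multiplicativity of \<chi> on the functionals
      \<open>elem\<close>.\<close>
    have "\<kappa> f y * \<kappa> g z = \<chi> (alg_mult (RE_dual D \<tau> (universal_R Hp D B)) (elem f y) (elem g z))"
      using \<chi> by (simp add: \<kappa>_def character_def)
    then show ?thesis
      by (simp add: RE_dual_mult_elem[OF \<tau>(1) \<tau>\<theta>] clinear_tensor_lift_apply[OF \<chi>_lin] \<sigma>_def \<kappa>_def)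
  qed
  ultimately have "y = counit Hp y *\<^sub>C ?u" for y
    by (intro trivial_if_fusion[of \<sigma> \<kappa>])
  then show False
    using dim_double_if_trivial assms(9) by blast
qed

end
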